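(* Let $\mathscr A$ be a profinitary cofinitary exact category with Hall algebra $H_{\mathscr A}$. For $\gamma\in\Gamma_{\mathscr A}^+=\Gamma_{\mathscr A}\setminus\{0\}$ let $m_\gamma=\#\mathrm{Ind}\,\mathscr A_\gamma-\dim_{\mathbb Q}\mathrm{Prim}(H_{\mathscr A})_\gamma$ and $P_\gamma=P\cap(H_{\mathscr A})_\gamma$, where $P=\ker\varepsilon\cdot\ker\varepsilon$ is the span of all products $[M][N]$ with $M,N$ non-zero. Then $$m_\gamma=\dim_{\mathbb Q}(P_\gamma\cap\mathbb Q\,\mathrm{Ind}\,\mathscr A_\gamma)$$ for all $\gamma\in\Gamma_{\mathscr A}^+$. In particular, if $\mathrm{Ind}\,\mathscr A_\gamma\subset P_\gamma$ then $\mathrm{Prim}(H_{\mathscr A})_\gamma=0$.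
   Context: All categories are essentially small; exact categories are in the sense of Quillen. $\mathrm{Iso}\,\mathscr A$ is the set of isomorphism classes $[X]$ of objects, an abelian monoid under $\oplus$. $\underline{\mathrm{Ext}}^1_{\mathscr A}(A,B)$ is the set of all $[X]$ such that there is a short exact sequence $B\rightarrowtail X\twoheadrightarrow A$. The Grothendieck monoid $\Gamma_{\mathscr A}$ is the quotient of $\mathrm{Iso}\,\mathscr A$ by the congruence which is the transitive closure of: $[X]\equiv[Y]$ if $[X],[Y]\in\underline{\mathrm{Ext}}^1_{\mathscr A}(M,N)$ for some $M,N$; $|X|$ is the image of $X$, and $\mathrm{Ind}\,\mathscr A_\gamma$ is the set of classes $[X]$ of indecomposable objects with $|X|=\gamma$. A Hom-finite exact category (all Hom sets finite) is profinitary if $\{[X]:|X|=\gamma\}$ is finite for all $\gamma$, and cofinitary if for every $[X]$ there are finitely many pairs $([A],[B])$ with $[X]\in\underline{\mathrm{Ext}}^1_{\mathscr A}(A,B)$. Let $\mathcal E(A,B)_X$ be the set of all short exact sequences $B\rightarrowtail X\twoheadrightarrow A$ and $F_{A,B}^X=\#\mathcal E(A,B)_X/(\#\mathrm{Aut}\,A\cdot\#\mathrm{Aut}\,B)$. The Hall algebra $H_{\mathscr A}$ is the $\mathbb Q$-vector space with basis $\mathrm{Iso}\,\mathscr A$, product $[A]\cdot[B]=\sum_{[C]}F_{A,B}^C[C]$, unit $1=[0]$, coproduct $\Delta([C])=\sum_{[A],[B]}F^{A,B}_C\,[A]\otimes[B]$ with $F^{A,B}_C=\frac{\#\mathrm{Aut}\,A\cdot\#\mathrm{Aut}\,B}{\#\mathrm{Aut}\,C}F_{B,A}^C$,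 counit $\varepsilon([C])=\delta_{[0],[C]}$, graded by $\Gamma_{\mathscr A}$ via $[M]\mapsto|M|$. $\mathrm{Prim}(H_{\mathscr A})=\{v:\Delta(v)=v\otimes1+1\otimes v\}$, a graded subspace. *)

theory Defs
  imports "HOL-Algebra.Group" "HOL-Library.Poly_Mapping" "HOL.Vector_Spaces" "HOL.Rat"
begin

section \<open>Additive categories\<close>

text \<open>
  Morphisms carry their source and target, so hom-sets between different pairs of objects
  are disjoint. Composition \<open>g \<star> f\<close> (first \<open>f\<close>, then \<open>g\<close>) is meaningful only if \<open>tgt f = src g\<close>.
\<close>

record ('o, 'm) cat =
  obj :: "'o set"
  arr :: "'m set"
  src :: "'m \<Rightarrow> 'o"
  tgt :: "'m \<Rightarrow> 'o"
  idt :: "'o \<Rightarrow> 'm"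
  cmp :: "'m \<Rightarrow> 'm \<Rightarrow> 'm"  (infixr "\<star>\<index>" 75)

definition homs :: "('o, 'm, 'x) cat_scheme \<Rightarrow> 'o \<Rightarrow> 'o \<Rightarrow> 'm set" where
  "homs C A B = {f \<in> arr C. src C f = A \<and> tgt C f = B}"

definition isos :: "('o, 'm, 'x) cat_scheme \<Rightarrow> 'o \<Rightarrow> 'o \<Rightarrow> 'm set" where
  "isos C A B = {f \<in> homs C A B.
     \<exists>g \<in> homs C B A. g \<star>\<^bsub>C\<^esub> f = idt C A \<and> f \<star>\<^bsub>C\<^esub> g = idt C B}"

abbreviation auts :: "('o, 'm, 'x) cat_scheme \<Rightarrow> 'o \<Rightarrow> 'm set" where
  "auts C A \<equiv> isos C A A"

definition is_zero_object :: "('o, 'm, 'x) cat_scheme \<Rightarrow> 'o \<Rightarrow> bool" where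
  "is_zero_object C Z \<longleftrightarrow> Z \<in> obj C \<and>
     (\<forall>A \<in> obj C. (\<exists>!f. f \<in> homs C A Z) \<and> (\<exists>!f. f \<in> homs C Z A))"

locale category =
  fixes C (structure)
  assumes arr_ends: "f \<in> arr C \<Longrightarrow> src C f \<in> obj C \<and> tgt C f \<in> obj C"
    and idt_hom: "A \<in> obj C \<Longrightarrow> idt C A \<in> homs C A A"
    and cmp_hom: "\<lbrakk>f \<in> homs C A B; g \<in> homs C B D\<rbrakk> \<Longrightarrow> g \<star> f \<in> homs C A D"
    and cmp_idt: "f \<in> homs C A B \<Longrightarrow> f \<star> idt C A = f \<and> idt C B \<star> f = f"
    and cmp_assoc: "\<lbrakk>f \<in> homs C A B; g \<in> homs C B D; h \<in> homs C D E\<rbrakk>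
      \<Longrightarrow> (h \<star> g) \<star> f = h \<star> (g \<star> f)"

record ('o, 'm) additive_cat = "('o, 'm) cat" +
  madd :: "'m \<Rightarrow> 'm \<Rightarrow> 'm"  (infixl "\<boxplus>\<index>" 65)
  zmor :: "'o \<Rightarrow> 'o \<Rightarrow> 'm"

definition hom_group :: "('o, 'm, 'x) additive_cat_scheme \<Rightarrow> 'o \<Rightarrow> 'o \<Rightarrow> 'm monoid" where
  "hom_group C A B = \<lparr>carrier = homs C A B, mult = madd C, one = zmor C A B\<rparr>"

definition is_biproduct ::
  "('o, 'm, 'x) additive_cat_scheme \<Rightarrow> 'o \<Rightarrow> 'o \<Rightarrow> 'o \<Rightarrow> 'm \<Rightarrow> 'm \<Rightarrow> 'm \<Rightarrow> 'm \<Rightarrow> bool" where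
  "is_biproduct C A B S i j p q \<longleftrightarrow>
     i \<in> homs C A S \<and> j \<in> homs C B S \<and> p \<in> homs C S A \<and> q \<in> homs C S B \<and>
     p \<star>\<^bsub>C\<^esub> i = idt C A \<and> q \<star>\<^bsub>C\<^esub> j = idt C B \<and>
     p \<star>\<^bsub>C\<^esub> j = zmor C B A \<and> q \<star>\<^bsub>C\<^esub> i = zmor C A B \<and>
     (i \<star>\<^bsub>C\<^esub> p) \<boxplus>\<^bsub>C\<^esub> (j \<star>\<^bsub>C\<^esub> q) = idt C S"

definition is_direct_sum :: "('o, 'm, 'x) additive_cat_scheme \<Rightarrow> 'o \<Rightarrow> 'o \<Rightarrow> 'o \<Rightarrow> bool" where
  "is_direct_sum C A B S \<longleftrightarrow>
     A \<in> obj C \<and> B \<in> obj C \<and> S \<in> obj C \<and> (\<exists>i j p q. is_biproduct C A B S i j p q)"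

locale additive_category = category C for C (structure) +
  assumes hom_comm_group: "\<lbrakk>A \<in> obj C; B \<in> obj C\<rbrakk> \<Longrightarrow> comm_group (hom_group C A B)"
    and cmp_madd_right: "\<lbrakk>f \<in> homs C A B; f' \<in> homs C A B; g \<in> homs C B D\<rbrakk>
      \<Longrightarrow> g \<star> (f \<boxplus> f') = (g \<star> f) \<boxplus> (g \<star> f')"
    and cmp_madd_left: "\<lbrakk>f \<in> homs C A B; g \<in> homs C B D; g' \<in> homs C B D\<rbrakk>
      \<Longrightarrow> (g \<boxplus> g') \<star> f = (g \<star> f) \<boxplus> (g' \<star> f)"
    and zero_object_ex: "\<exists>Z. is_zero_object C Z"
    and direct_sum_ex: "\<lbrakk>A \<in> obj C; B \<in> obj C\<rbrakk> \<Longrightarrow> \<exists>S. is_direct_sum C A B S"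


section \<open>Exact categories in the sense of Quillen\<close>

definition is_kernel :: "('o, 'm, 'x) additive_cat_scheme \<Rightarrow> 'm \<Rightarrow> 'm \<Rightarrow> bool" where
  "is_kernel C i p \<longleftrightarrow> i \<in> arr C \<and> p \<in> arr C \<and> tgt C i = src C p \<and>
     p \<star>\<^bsub>C\<^esub> i = zmor C (src C i) (tgt C p) \<and>
     (\<forall>T \<in> obj C. \<forall>g \<in> homs C T (src C p). p \<star>\<^bsub>C\<^esub> g = zmor C T (tgt C p) \<longrightarrow>
        (\<exists>!h. h \<in> homs C T (src C i) \<and> i \<star>\<^bsub>C\<^esub> h = g))"

definition is_cokernel :: "('o, 'm, 'x) additive_cat_scheme \<Rightarrow> 'm \<Rightarrow> 'm \<Rightarrow> bool" where
  "is_cokernel C p i \<longleftrightarrow> i \<in> arr C \<and> p \<in> arr C \<and> tgt C i = src C p \<and>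
     p \<star>\<^bsub>C\<^esub> i = zmor C (src C i) (tgt C p) \<and>
     (\<forall>T \<in> obj C. \<forall>g \<in> homs C (tgt C i) T. g \<star>\<^bsub>C\<^esub> i = zmor C (src C i) T \<longrightarrow>
        (\<exists>!h. h \<in> homs C (tgt C p) T \<and> h \<star>\<^bsub>C\<^esub> p = g))"

text \<open>\<open>is_pullback C f g f' g'\<close>: the square \<open>f \<star> g' = g \<star> f'\<close> is cartesian, so that
  \<open>f'\<close> is the base change of \<open>f\<close> along \<open>g\<close> and \<open>g'\<close> that of \<open>g\<close> along \<open>f\<close>.
  Dually, in \<open>is_pushout C f g f' g'\<close> the map \<open>f'\<close> is the cobase change of \<open>f\<close> along \<open>g\<close>.\<close>

definition is_pullback :: "('o, 'm, 'x) cat_scheme \<Rightarrow> 'm \<Rightarrow> 'm \<Rightarrow> 'm \<Rightarrow> 'm \<Rightarrow> bool" where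
  "is_pullback C f g f' g' \<longleftrightarrow>
     f \<in> arr C \<and> g \<in> arr C \<and> f' \<in> arr C \<and> g' \<in> arr C \<and>
     tgt C f = tgt C g \<and> src C f' = src C g' \<and> tgt C f' = src C g \<and> tgt C g' = src C f \<and>
     f \<star>\<^bsub>C\<^esub> g' = g \<star>\<^bsub>C\<^esub> f' \<and>
     (\<forall>T \<in> obj C. \<forall>u \<in> homs C T (src C f). \<forall>v \<in> homs C T (src C g). f \<star>\<^bsub>C\<^esub> u = g \<star>\<^bsub>C\<^esub> v \<longrightarrow>
        (\<exists>!h. h \<in> homs C T (src C f') \<and> g' \<star>\<^bsub>C\<^esub> h = u \<and> f' \<star>\<^bsub>C\<^esub> h = v))"

definition is_pushout :: "('o, 'm, 'x) cat_scheme \<Rightarrow> 'm \<Rightarrow> 'm \<Rightarrow> 'm \<Rightarrow> 'm \<Rightarrow> bool" where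
  "is_pushout C f g f' g' \<longleftrightarrow>
     f \<in> arr C \<and> g \<in> arr C \<and> f' \<in> arr C \<and> g' \<in> arr C \<and>
     src C f = src C g \<and> tgt C f' = tgt C g' \<and> src C f' = tgt C g \<and> src C g' = tgt C f \<and>
     g' \<star>\<^bsub>C\<^esub> f = f' \<star>\<^bsub>C\<^esub> g \<and>
     (\<forall>T \<in> obj C. \<forall>u \<in> homs C (tgt C f) T. \<forall>v \<in> homs C (tgt C g) T. u \<star>\<^bsub>C\<^esub> f = v \<star>\<^bsub>C\<^esub> g \<longrightarrow>
        (\<exists>!h. h \<in> homs C (tgt C f') T \<and> h \<star>\<^bsub>C\<^esub> g' = u \<and> h \<star>\<^bsub>C\<^esub> f' = v))"

text \<open>\<open>confl\<close> is the distinguished class of short exact sequences, as pairs of the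
  admissible monomorphism and the admissible epimorphism.\<close>

record ('o, 'm) exact_cat = "('o, 'm) additive_cat" +
  confl :: "('m \<times> 'm) set"

definition adm_mono :: "('o, 'm, 'x) exact_cat_scheme \<Rightarrow> 'm \<Rightarrow> bool" where
  "adm_mono C i \<longleftrightarrow> (\<exists>p. (i, p) \<in> confl C)"

definition adm_epi :: "('o, 'm, 'x) exact_cat_scheme \<Rightarrow> 'm \<Rightarrow> bool" where
  "adm_epi C p \<longleftrightarrow> (\<exists>i. (i, p) \<in> confl C)"

text \<open>Quillen's original list of axioms; the last two are known to be redundant.\<close>

locale exact_category = additive_category C for C (structure) +
  assumes confl_kernel_cokernel: "(i, p) \<in> confl C \<Longrightarrow> is_kernel C i p \<and> is_cokernel C p i"
    and confl_iso_closed: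
      "\<lbrakk>(i, p) \<in> confl C; i \<in> homs C B X; p \<in> homs C X A; i' \<in> homs C B' X'; p' \<in> homs C X' A';
        b \<in> isos C B B'; x \<in> isos C X X'; a \<in> isos C A A'; x \<star> i = i' \<star> b; a \<star> p = p' \<star> x\<rbrakk>
       \<Longrightarrow> (i', p') \<in> confl C"
    and confl_split:
      "\<lbrakk>A \<in> obj C; B \<in> obj C; S \<in> obj C; is_biproduct C A B S i j p q\<rbrakk> \<Longrightarrow> (i, q) \<in> confl C"
    and adm_epi_cmp: "\<lbrakk>adm_epi C p; adm_epi C q; tgt C p = src C q\<rbrakk> \<Longrightarrow> adm_epi C (q \<star> p)"
    and adm_mono_cmp: "\<lbrakk>adm_mono C i; adm_mono C j; tgt C i = src C j\<rbrakk> \<Longrightarrow> adm_mono C (j \<star> i)"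
    and adm_epi_base_change: "\<lbrakk>adm_epi C p; f \<in> arr C; tgt C f = tgt C p\<rbrakk>
      \<Longrightarrow> \<exists>p' f'. is_pullback C p f p' f' \<and> adm_epi C p'"
    and adm_mono_cobase_change: "\<lbrakk>adm_mono C i; f \<in> arr C; src C f = src C i\<rbrakk>
      \<Longrightarrow> \<exists>i' f'. is_pushout C i f i' f' \<and> adm_mono C i'"
    and adm_epi_cancel: "\<lbrakk>f \<in> arr C; g \<in> arr C; tgt C g = src C f; adm_epi C (f \<star> g);
        \<exists>k. is_kernel C k f\<rbrakk> \<Longrightarrow> adm_epi C f"
    and adm_mono_cancel: "\<lbrakk>f \<in> arr C; g \<in> arr C; src C g = tgt C f; adm_mono C (g \<star> f);
        \<exists>k. is_cokernel C k f\<rbrakk> \<Longrightarrow> adm_mono C f"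


section \<open>Isomorphism classes and the Grothendieck monoid\<close>

definition iso_class :: "('o, 'm, 'x) cat_scheme \<Rightarrow> 'o \<Rightarrow> 'o set" where
  "iso_class C X = {Y \<in> obj C. isos C X Y \<noteq> {}}"

definition Iso :: "('o, 'm, 'x) cat_scheme \<Rightarrow> 'o set set" where
  "Iso C = iso_class C ` obj C"

text \<open>The classes \<open>[0]\<close> and \<open>[X \<oplus> Y]\<close>, written without choosing a zero object or a direct sum.\<close>

definition zero_iso_class :: "('o, 'm, 'x) cat_scheme \<Rightarrow> 'o set" where
  "zero_iso_class C = {Z. is_zero_object C Z}"

definition sum_class :: "('o, 'm, 'x) additive_cat_scheme \<Rightarrow> 'o set \<Rightarrow> 'o set \<Rightarrow> 'o set" where
  "sum_class C a b = {S. \<exists>A \<in> a. \<exists>B \<in> b. is_direct_sum C A B S}"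

text \<open>The short exact sequences \<open>B \<rightarrowtail> X \<twoheadrightarrow> A\<close>.\<close>

definition ses :: "('o, 'm, 'x) exact_cat_scheme \<Rightarrow> 'o \<Rightarrow> 'o \<Rightarrow> 'o \<Rightarrow> ('m \<times> 'm) set" where
  "ses C A B X = {(i, p) \<in> confl C. i \<in> homs C B X \<and> p \<in> homs C X A}"

definition Ext1 :: "('o, 'm, 'x) exact_cat_scheme \<Rightarrow> 'o \<Rightarrow> 'o \<Rightarrow> 'o set set" where
  "Ext1 C A B = {iso_class C X | X. X \<in> obj C \<and> ses C A B X \<noteq> {}}"

definition groth_cong :: "('o, 'm, 'x) exact_cat_scheme \<Rightarrow> ('o set \<times> 'o set) set" where
  "groth_cong C = {(x, y). \<exists>M \<in> obj C. \<exists>N \<in> obj C. x \<in> Ext1 C M N \<and> y \<in> Ext1 C M N}\<^sup>+"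

text \<open>The image in the Grothendieck monoid of an isomorphism class, and of an object.\<close>

definition class_degree :: "('o, 'm, 'x) exact_cat_scheme \<Rightarrow> 'o set \<Rightarrow> 'o set set" where
  "class_degree C a = groth_cong C `` {a}"

definition degree :: "('o, 'm, 'x) exact_cat_scheme \<Rightarrow> 'o \<Rightarrow> 'o set set" where
  "degree C X = class_degree C (iso_class C X)"

definition Groth :: "('o, 'm, 'x) exact_cat_scheme \<Rightarrow> 'o set set monoid" where
  "Groth C = \<lparr>carrier = Iso C // groth_cong C,
     mult = (\<lambda>g h. \<Union>a \<in> g. \<Union>b \<in> h. class_degree C (sum_class C a b)),
     one = class_degree C (zero_iso_class C)\<rparr>"

definition indecomposable :: "('o, 'm, 'x) additive_cat_scheme \<Rightarrow> 'o \<Rightarrow> bool" where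
  "indecomposable C X \<longleftrightarrow> X \<in> obj C \<and> \<not> is_zero_object C X \<and>
     (\<forall>A B. is_direct_sum C A B X \<longrightarrow> is_zero_object C A \<or> is_zero_object C B)"

definition Ind :: "('o, 'm, 'x) exact_cat_scheme \<Rightarrow> 'o set set \<Rightarrow> 'o set set" where
  "Ind C \<gamma> = {iso_class C X | X. indecomposable C X \<and> degree C X = \<gamma>}"

definition hom_finite :: "('o, 'm, 'x) cat_scheme \<Rightarrow> bool" where
  "hom_finite C \<longleftrightarrow> (\<forall>A \<in> obj C. \<forall>B \<in> obj C. finite (homs C A B))"

definition profinitary :: "('o, 'm, 'x) exact_cat_scheme \<Rightarrow> bool" where
  "profinitary C \<longleftrightarrow> exact_category C \<and> hom_finite C \<and>
     (\<forall>\<gamma> \<in> carrier (Groth C). finite {iso_class C X | X. X \<in> obj C \<and> degree C X = \<gamma>})"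

definition cofinitary :: "('o, 'm, 'x) exact_cat_scheme \<Rightarrow> bool" where
  "cofinitary C \<longleftrightarrow> exact_category C \<and> hom_finite C \<and>
     (\<forall>X \<in> obj C. finite {(iso_class C A, iso_class C B) | A B.
        A \<in> obj C \<and> B \<in> obj C \<and> iso_class C X \<in> Ext1 C A B})"


section \<open>The Hall algebra\<close>

text \<open>Finitely supported functions \<open>'b \<Rightarrow>\<^sub>0 rat\<close> form the rational vector space with basis \<open>'b\<close>.\<close>

definition qscale :: "rat \<Rightarrow> ('b \<Rightarrow>\<^sub>0 rat) \<Rightarrow> ('b \<Rightarrow>\<^sub>0 rat)" where
  "qscale c v = Poly_Mapping.map ((*) c) v"

lemma lookup_qscale [simp]: "Poly_Mapping.lookup (qscale c v) b = c * Poly_Mapping.lookup v b"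
  by (simp add: qscale_def Poly_Mapping.map.rep_eq when_def)

interpretation qvs: vector_space "qscale :: rat \<Rightarrow> ('b \<Rightarrow>\<^sub>0 rat) \<Rightarrow> ('b \<Rightarrow>\<^sub>0 rat)"
  by unfold_locales (rule poly_mapping_eqI; simp add: lookup_add algebra_simps)+

definition bvec :: "'b \<Rightarrow> ('b \<Rightarrow>\<^sub>0 rat)" where
  "bvec b = Poly_Mapping.single b 1"

text \<open>\<open>hall_num C A B X\<close> is \<open>F\<^sub>A\<^sub>,\<^sub>B\<^sup>X\<close>. It depends only on the isomorphism classes of the objects,
  so that it may be evaluated on arbitrary representatives.\<close>

definition hall_num :: "('o, 'm, 'x) exact_cat_scheme \<Rightarrow> 'o \<Rightarrow> 'o \<Rightarrow> 'o \<Rightarrow> rat" where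
  "hall_num C A B X =
     of_nat (card (ses C A B X)) / (of_nat (card (auts C A)) * of_nat (card (auts C B)))"

definition rep :: "'o set \<Rightarrow> 'o" where
  "rep a = (SOME X. X \<in> a)"

definition class_hall_num :: "('o, 'm, 'x) exact_cat_scheme \<Rightarrow> 'o set \<Rightarrow> 'o set \<Rightarrow> 'o set \<Rightarrow> rat" where
  "class_hall_num C a b c = hall_num C (rep a) (rep b) (rep c)"

text \<open>\<open>class_hall_conum C a b c\<close> is \<open>F\<^sup>A\<^sup>,\<^sup>B\<^sub>C\<close>; note the interchange of \<open>A\<close> and \<open>B\<close>.\<close>

definition class_hall_conum :: "('o, 'm, 'x) exact_cat_scheme \<Rightarrow> 'o set \<Rightarrow> 'o set \<Rightarrow> 'o set \<Rightarrow> rat" where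
  "class_hall_conum C a b c =
     of_nat (card (auts C (rep a))) * of_nat (card (auts C (rep b))) / of_nat (card (auts C (rep c)))
       * class_hall_num C b a c"

definition hall_space :: "('o, 'm, 'x) cat_scheme \<Rightarrow> ('o set \<Rightarrow>\<^sub>0 rat) set" where
  "hall_space C = qvs.span (bvec ` Iso C)"

definition hall_graded :: "('o, 'm, 'x) exact_cat_scheme \<Rightarrow> 'o set set \<Rightarrow> ('o set \<Rightarrow>\<^sub>0 rat) set" where
  "hall_graded C \<gamma> = qvs.span {bvec (iso_class C M) | M. M \<in> obj C \<and> degree C M = \<gamma>}"

text \<open>The sums over \<open>c\<close> and over \<open>(a, b)\<close> below are restricted to the nonzero structure constants.
  These are finite in number for profinitary resp. cofinitary \<open>C\<close>
  (otherwise \<open>sum\<close> would silently return 0).\<close>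

definition hall_mult_basis :: "('o, 'm, 'x) exact_cat_scheme \<Rightarrow> 'o set \<Rightarrow> 'o set \<Rightarrow> ('o set \<Rightarrow>\<^sub>0 rat)" where
  "hall_mult_basis C a b =
     (\<Sum>c \<in> {c \<in> Iso C. class_hall_num C a b c \<noteq> 0}. qscale (class_hall_num C a b c) (bvec c))"

definition hall_mult ::
  "('o, 'm, 'x) exact_cat_scheme \<Rightarrow> ('o set \<Rightarrow>\<^sub>0 rat) \<Rightarrow> ('o set \<Rightarrow>\<^sub>0 rat) \<Rightarrow> ('o set \<Rightarrow>\<^sub>0 rat)" where
  "hall_mult C v w = (\<Sum>a \<in> Poly_Mapping.keys v. \<Sum>b \<in> Poly_Mapping.keys w.
     qscale (Poly_Mapping.lookup v a * Poly_Mapping.lookup w b) (hall_mult_basis C a b))"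

definition hall_one :: "('o, 'm, 'x) cat_scheme \<Rightarrow> ('o set \<Rightarrow>\<^sub>0 rat)" where
  "hall_one C = bvec (zero_iso_class C)"

text \<open>The tensor square of the space with basis \<open>'b\<close> is the space with basis \<open>'b \<times> 'b\<close>.\<close>

definition tensor :: "('b \<Rightarrow>\<^sub>0 rat) \<Rightarrow> ('b \<Rightarrow>\<^sub>0 rat) \<Rightarrow> ('b \<times> 'b \<Rightarrow>\<^sub>0 rat)" where
  "tensor v w = (\<Sum>a \<in> Poly_Mapping.keys v. \<Sum>b \<in> Poly_Mapping.keys w.
     qscale (Poly_Mapping.lookup v a * Poly_Mapping.lookup w b) (bvec (a, b)))"

definition hall_comult_basis ::
  "('o, 'm, 'x) exact_cat_scheme \<Rightarrow> 'o set \<Rightarrow> ('o set \<times> 'o set \<Rightarrow>\<^sub>0 rat)" where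
  "hall_comult_basis C c =
     (\<Sum>(a, b) \<in> {(a, b). a \<in> Iso C \<and> b \<in> Iso C \<and> class_hall_conum C a b c \<noteq> 0}.
        qscale (class_hall_conum C a b c) (tensor (bvec a) (bvec b)))"

definition hall_comult ::
  "('o, 'm, 'x) exact_cat_scheme \<Rightarrow> ('o set \<Rightarrow>\<^sub>0 rat) \<Rightarrow> ('o set \<times> 'o set \<Rightarrow>\<^sub>0 rat)" where
  "hall_comult C v =
     (\<Sum>c \<in> Poly_Mapping.keys v. qscale (Poly_Mapping.lookup v c) (hall_comult_basis C c))"

definition hall_counit :: "('o, 'm, 'x) cat_scheme \<Rightarrow> ('o set \<Rightarrow>\<^sub>0 rat) \<Rightarrow> rat" where
  "hall_counit C v =
     (\<Sum>c \<in> Poly_Mapping.keys v. Poly_Mapping.lookup v c * (if c = zero_iso_class C then 1 else 0))"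

definition Prim :: "('o, 'm, 'x) exact_cat_scheme \<Rightarrow> ('o set \<Rightarrow>\<^sub>0 rat) set" where
  "Prim C = {v \<in> hall_space C. hall_comult C v = tensor v (hall_one C) + tensor (hall_one C) v}"

definition Prim_graded :: "('o, 'm, 'x) exact_cat_scheme \<Rightarrow> 'o set set \<Rightarrow> ('o set \<Rightarrow>\<^sub>0 rat) set" where
  "Prim_graded C \<gamma> = Prim C \<inter> hall_graded C \<gamma>"

definition ker_counit :: "('o, 'm, 'x) cat_scheme \<Rightarrow> ('o set \<Rightarrow>\<^sub>0 rat) set" where
  "ker_counit C = {v \<in> hall_space C. hall_counit C v = 0}"

definition hall_P :: "('o, 'm, 'x) exact_cat_scheme \<Rightarrow> ('o set \<Rightarrow>\<^sub>0 rat) set" where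
  "hall_P C = qvs.span {hall_mult C v w | v w. v \<in> ker_counit C \<and> w \<in> ker_counit C}"

definition hall_P_graded :: "('o, 'm, 'x) exact_cat_scheme \<Rightarrow> 'o set set \<Rightarrow> ('o set \<Rightarrow>\<^sub>0 rat) set" where
  "hall_P_graded C \<gamma> = hall_P C \<inter> hall_graded C \<gamma>"

definition hall_m :: "('o, 'm, 'x) exact_cat_scheme \<Rightarrow> 'o set set \<Rightarrow> int" where
  "hall_m C \<gamma> = int (card (Ind C \<gamma>)) - int (qvs.dim (Prim_graded C \<gamma>))"

end

theory Submission
  imports Defs
begin

text \<open>
  The form \<open>\<langle>[A], [B]\<rangle> = \<delta> / #Aut A\<close> makes the coproduct adjoint to the (opposite) product, since
  both structure constants are \<open>F\<^sub>B\<^sub>,\<^sub>A\<^sup>C / #Aut C\<close> up to the factors on \<open>A\<close> and \<open>B\<close>. Hence for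
  \<open>\<gamma> \<noteq> 0\<close> the primitive elements of degree \<open>\<gamma>\<close> are the orthogonal complement of \<open>P\<^sub>\<gamma>\<close> in the
  degree \<open>\<gamma>\<close> part \<open>H\<^sub>\<gamma>\<close>, which is finite-dimensional, and the form is positive definite. It remains
  to see that \<open>H\<^sub>\<gamma>\<close> is the sum of \<open>P\<^sub>\<gamma>\<close> and the span of the indecomposables. By left exactness of Hom,
  the middle term of a nonsplit sequence \<open>B \<rightarrowtail> X \<twoheadrightarrow> A\<close> has fewer endomorphisms than \<open>A \<oplus> B\<close>, so
  \<open>[A \<oplus> B]\<close> is a multiple of \<open>[A][B]\<close> up to classes with fewer endomorphisms, and induction applies.
\<close>

section \<open>Dimension formulas\<close>

context vector_space
begin

text \<open>Induction on \<open>B\<close>: if a new \<open>b\<close> were \<open>x + y\<close> with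
  \<open>x\<close> in \<open>span A\<close> and \<open>y\<close> in \<open>span B\<close>, then
  \<open>x = b - y\<close> would lie in both spans and vanish, leaving \<open>b\<close> in
  \<open>span B\<close>.\<close>

lemma independent_Un:
  assumes "independent A" "independent B" "span A \<inter> span B = {0}" "finite B"
  shows "independent (A \<union> B)"
  using assms(4,2,3)
proof (induction B rule: finite_induct)
  case empty
  then show ?case using assms(1) by simp
next
  case (insert b B)
  have ind: "independent B"
    using insert.prems(1) by (rule independent_mono) auto
  have "span B \<subseteq> span (insert b B)"
    by (rule span_mono) auto
  then have int: "span A \<inter> span B = {0}"
    using insert.prems(2) span_zero by blast
  have "b \<notin> span (A \<union> B)"
  proof
    assume "b \<in> span (A \<union> B)"
    then obtain x y where xy: "x \<in> span A" "y \<in> span B" "b = x + y"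
      by (auto simp: span_Un)
    have "y \<in> span (insert b B)"
      using xy(2) span_mono[of B "insert b B"] by blast
    then have "b - y \<in> span (insert b B)"
      using span_diff span_base insertI1 by metis
    then have "x \<in> span A \<inter> span (insert b B)"
      using xy by simp
    then have "x = 0"
      using insert.prems(2) by blast
    then have "b \<in> span B"
      using xy by simp
    moreover have "b \<notin> span B"
      using insert.prems(1) insert.hyps(2) by (simp add: independent_insert)
    ultimately show False by blast
  qed
  then show ?case
    using insert.IH[OF ind int] by (simp add: independent_insertI)
qed

text \<open>Coordinates with respect to \<open>D\<close> are unique. A common element has its
  coordinates supported in \<open>A\<close> and also in \<open>B\<close>, so all of them are
  zero.\<close>

lemma independent_span_Int:
  assumes "independent D" "A \<subseteq> D" "B \<subseteq> D" "A \<inter> B = {}"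
  shows "span A \<inter> span B = {0}"
proof -
  have "x = 0" if "x \<in> span A" "x \<in> span B" for x
  proof -
    have "representation D x b = 0" for b
      using representation_extend[OF assms(1) that(1) assms(2)]
        representation_extend[OF assms(1) that(2) assms(3)]
        representation_ne_zero[of A x b] representation_ne_zero[of B x b] assms(4)
      by fastforce
    moreover have "x \<in> span D"
      using that(1) span_mono[OF assms(2)] by blast
    ultimately show "x = 0"
      using sum_nonzero_representation_eq[OF assms(1)] by force
  qed
  then show ?thesis
    using span_zero by blast
qed

text \<open>Grassmann's formula, for an ambient space of any dimension; \<open>E\<close> supplies
  the finiteness. A basis \<open>B\<close> of the intersection is extended to bases \<open>K\<close>
  of \<open>U\<close> and \<open>D\<close> of \<open>W\<close>, and
  \<open>K \<union> (D - B)\<close> is a basis of the sum.\<close>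

lemma dim_sums_Int_finite_span:
  assumes "subspace U" "subspace W" and E: "finite E" "U \<subseteq> span E" "W \<subseteq> span E"
  shows "dim {x + y | x y. x \<in> U \<and> y \<in> W} + dim (U \<inter> W) = dim U + dim W"
proof -
  obtain B where B: "B \<subseteq> U \<inter> W" "independent B" "U \<inter> W \<subseteq> span B"
    using maximal_independent_subset by blast
  obtain K where K: "B \<subseteq> K" "K \<subseteq> U" "independent K" "U \<subseteq> span K"
    using maximal_independent_subset_extend[of B U] B by blast
  obtain D where D: "B \<subseteq> D" "D \<subseteq> W" "independent D" "W \<subseteq> span D"
    using maximal_independent_subset_extend[of B W] B by blast
  have fin: "finite K" "finite D"
    using independent_span_bound[OF E(1) K(3)] independent_span_bound[OF E(1) D(3)] K(2) D(2) E(2,3)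
    by auto
  have "K \<inter> (D - B) = {}"
  proof -
    have False if "x \<in> K" "x \<in> D" "x \<notin> B" for x
    proof -
      have "x \<in> span B" using that B K D by blast
      then have "x \<in> span (K - {x})"
        using that K(1) span_mono[of B "K - {x}"] by blast
      then show False
        using K(3) that(1) by (auto simp: dependent_def)
    qed
    then show ?thesis by blast
  qed
  have spK: "span K = U" "span D = W"
    using K D assms(1,2) by (simp_all add: span_subspace)
  \<comment> \<open>A common element lies in both \<open>U\<close> and \<open>W\<close>, hence in
    \<open>span B\<close>; independence of \<open>D\<close> then separates \<open>span B\<close>
    from \<open>span (D - B)\<close>.\<close>
  have "span K \<inter> span (D - B) \<subseteq> {0}"
  proof -
    have "span (D - B) \<subseteq> W" using spK span_mono[of "D - B" D] by blast
    then have "span K \<inter> span (D - B) \<subseteq> span B \<inter> span (D - B)"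
      using spK B by blast
    also have "\<dots> = {0}"
      using D by (intro independent_span_Int[of D]) auto
    finally show ?thesis .
  qed
  then have "span K \<inter> span (D - B) = {0}"
    using span_zero by blast
  then have "independent (K \<union> (D - B))"
    using K(3) independent_mono[OF D(3), of "D - B"] fin by (intro independent_Un) auto
  moreover have "K \<union> (D - B) = K \<union> D"
    using K(1) by blast
  moreover have "span (K \<union> D) = {x + y | x y. x \<in> U \<and> y \<in> W}"
    by (simp add: span_Un spK)
  ultimately have "dim {x + y | x y. x \<in> U \<and> y \<in> W} = card (K \<union> (D - B))"
    by (metis dim_span_eq_card_independent)
  also have "\<dots> = card K + (card D - card B)"
    using fin D(1) \<open>K \<inter> (D - B) = {}\<close> finite_subset[OF D(1)]
    by (simp add: card_Un_disjoint card_Diff_subset)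
  finally have "dim {x + y | x y. x \<in> U \<and> y \<in> W} = card K + (card D - card B)" .
  moreover have "dim (U \<inter> W) = card B"
    by (rule dim_unique[OF B(1) B(3) B(2)]) simp
  moreover have "dim U = card K"
    by (rule dim_unique[OF K(2) K(4) K(3)]) simp
  moreover have "dim W = card D"
    by (rule dim_unique[OF D(2) D(4) D(3)]) simp
  moreover have "card B \<le> card D"
    using D(1) fin by (simp add: card_mono)
  ultimately show ?thesis by simp
qed

end

section \<open>Diagonal bilinear forms and orthogonal complements\<close>

definition wform :: "('b \<Rightarrow> rat) \<Rightarrow> ('b \<Rightarrow>\<^sub>0 rat) \<Rightarrow> ('b \<Rightarrow>\<^sub>0 rat) \<Rightarrow> rat" where
  "wform \<omega> v w = (\<Sum>b \<in> Poly_Mapping.keys v. \<omega> b * Poly_Mapping.lookup v b * Poly_Mapping.lookup w b)"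

lemma wform_eq_sum:
  "finite F \<Longrightarrow> Poly_Mapping.keys v \<subseteq> F \<Longrightarrow>
    wform \<omega> v w = (\<Sum>b \<in> F. \<omega> b * Poly_Mapping.lookup v b * Poly_Mapping.lookup w b)"
  unfolding wform_def by (rule sum.mono_neutral_left) (auto simp: in_keys_iff)

text \<open>The definition sums over the support of the first argument only. Enlarging the index set
  to the union of both supports makes the expression symmetric.\<close>

lemma wform_commute: "wform \<omega> v w = wform \<omega> w v"
proof -
  let ?F = "Poly_Mapping.keys v \<union> Poly_Mapping.keys w"
  have "wform \<omega> v w = (\<Sum>b \<in> ?F. \<omega> b * Poly_Mapping.lookup v b * Poly_Mapping.lookup w b)"
    by (rule wform_eq_sum) auto
  also have "\<dots> = (\<Sum>b \<in> ?F. \<omega> b * Poly_Mapping.lookup w b * Poly_Mapping.lookup v b)"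
    by (simp add: mult_ac)
  also have "\<dots> = wform \<omega> w v"
    by (rule wform_eq_sum[symmetric]) auto
  finally show ?thesis .
qed

lemma wform_add_right: "wform \<omega> v (w + w') = wform \<omega> v w + wform \<omega> v w'"
  by (simp add: wform_def lookup_add algebra_simps sum.distrib)

lemma wform_scale_right: "wform \<omega> v (qscale c w) = c * wform \<omega> v w"
  by (simp add: wform_def sum_distrib_left mult_ac)

lemma wform_zero_right [simp]: "wform \<omega> v 0 = 0"
  by (simp add: wform_def)

lemma wform_diff_right: "wform \<omega> v (w - w') = wform \<omega> v w - wform \<omega> v w'"
  by (simp add: wform_def lookup_minus algebra_simps sum_subtractf)

lemma subspace_wform_kernel: "qvs.subspace {w. wform \<omega> v w = 0}"
  by (rule qvs.subspaceI) (simp_all add: wform_add_right wform_scale_right)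

text \<open>Turns membership in a coordinate subspace into a condition on supports; the later
  arguments about degrees are carried out in this form.\<close>

lemma span_bvec: "qvs.span (bvec ` S) = {v. Poly_Mapping.keys v \<subseteq> S}"
proof
  have "qvs.subspace {v. Poly_Mapping.keys v \<subseteq> S}"
  proof (rule qvs.subspaceI)
    fix x y :: "'a \<Rightarrow>\<^sub>0 rat"
    assume "x \<in> {v. Poly_Mapping.keys v \<subseteq> S}" "y \<in> {v. Poly_Mapping.keys v \<subseteq> S}"
    then show "x + y \<in> {v. Poly_Mapping.keys v \<subseteq> S}"
      using keys_add[of x y] by blast
  qed (auto simp: in_keys_iff)
  then show "qvs.span (bvec ` S) \<subseteq> {v. Poly_Mapping.keys v \<subseteq> S}"
    by (intro qvs.span_minimal) (auto simp: bvec_def)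
next
  show "{v. Poly_Mapping.keys v \<subseteq> S} \<subseteq> qvs.span (bvec ` S)"
  proof
    fix v :: "'a \<Rightarrow>\<^sub>0 rat"
    assume "v \<in> {v. Poly_Mapping.keys v \<subseteq> S}"
    then have "(\<Sum>b \<in> Poly_Mapping.keys v. qscale (Poly_Mapping.lookup v b) (bvec b)) \<in> qvs.span (bvec ` S)"
      by (intro qvs.span_sum qvs.span_scale qvs.span_base) auto
    also have "(\<Sum>b \<in> Poly_Mapping.keys v. qscale (Poly_Mapping.lookup v b) (bvec b)) = v"
      by (rule poly_mapping_eqI)
        (auto simp: lookup_sum bvec_def lookup_single when_def if_distrib in_keys_iff cong: if_cong)
    finally show "v \<in> qvs.span (bvec ` S)" .
  qed
qed

lemma inj_bvec: "inj bvec"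
proof (rule injI)
  fix a b :: 'a
  assume "bvec a = bvec b"
  then have "Poly_Mapping.keys (bvec a) = Poly_Mapping.keys (bvec b)" by simp
  then show "a = b" by (simp add: bvec_def)
qed

text \<open>By \<open>span_bvec\<close>, a dependence would put the support \<open>{b}\<close> of
  \<open>bvec b\<close> inside \<open>S - {b}\<close>.\<close>

lemma independent_bvec: "qvs.independent (bvec ` S)"
  unfolding qvs.dependent_def
proof (safe)
  fix b assume "b \<in> S" and "bvec b \<in> qvs.span (bvec ` S - {bvec b})"
  moreover have "bvec ` S - {bvec b} = bvec ` (S - {b})"
    using inj_bvec by (auto simp: inj_def)
  ultimately show False
    by (simp add: span_bvec) (simp add: bvec_def)
qed

lemma dim_span_bvec: "qvs.dim (qvs.span (bvec ` S)) = card S"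
  using qvs.dim_span_eq_card_independent[OF independent_bvec] inj_bvec
  by (metis card_image inj_on_subset subset_UNIV)

text \<open>Positive definiteness: a sum of nonnegative terms is zero only if each term is, and over
  the rationals this kills every coordinate in the support.\<close>

lemma wform_pos:
  assumes "\<And>b. b \<in> Poly_Mapping.keys v \<Longrightarrow> \<omega> b > 0" and "wform \<omega> v v = 0"
  shows "v = 0"
proof -
  have "\<forall>b \<in> Poly_Mapping.keys v. \<omega> b * Poly_Mapping.lookup v b * Poly_Mapping.lookup v b = 0"
    using assms(2) assms(1) unfolding wform_def
    by (subst (asm) sum_nonneg_eq_0_iff)
      (auto simp: mult.assoc zero_le_mult_iff intro: less_imp_le)
  then have "Poly_Mapping.keys v = {}"
    using assms(1) by (metis equals0I in_keys_iff less_irrefl mult_eq_0_iff)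
  then show ?thesis by simp
qed

text \<open>One step of Gram-Schmidt per element of \<open>B\<close>: the new vector
  \<open>b\<close> is replaced by its component \<open>d\<close> orthogonal to
  \<open>span B\<close>, and the projection already found is corrected by a multiple of
  \<open>d\<close>.\<close>

lemma orthogonal_projection_exists:
  assumes \<omega>: "\<And>b. b \<in> S \<Longrightarrow> \<omega> b > 0" and "finite B"
    and "B \<subseteq> qvs.span (bvec ` S)" and "v \<in> qvs.span (bvec ` S)"
  shows "\<exists>u \<in> qvs.span B. \<forall>b \<in> qvs.span B. wform \<omega> b (v - u) = 0"
  using assms(2,3,4)
proof (induction B arbitrary: v rule: finite_induct)
  case empty
  then show ?case by (simp add: wform_commute[of \<omega> 0])
next
  case (insert b B)
  obtain p where p: "p \<in> qvs.span B" "\<And>x. x \<in> qvs.span B \<Longrightarrow> wform \<omega> x (b - p) = 0"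
    using insert.IH[of b] insert.prems by auto
  obtain u where u: "u \<in> qvs.span B" "\<And>x. x \<in> qvs.span B \<Longrightarrow> wform \<omega> x (v - u) = 0"
    using insert.IH[of v] insert.prems by auto
  define d where "d = b - p"
  \<comment> \<open>The coefficient of \<open>v - u\<close> along \<open>d\<close>. If
    \<open>wform \<omega> d d = 0\<close>, division gives \<open>t = 0\<close>; this is harmless,
    since then \<open>d = 0\<close> by positivity.\<close>
  define t where "t = wform \<omega> d (v - u) / wform \<omega> d d"
  have sub: "qvs.span B \<subseteq> qvs.span (insert b B)"
    by (rule qvs.span_mono) auto
  have d: "d \<in> qvs.span (insert b B)"
    unfolding d_def using p sub by (metis insertI1 qvs.span_base qvs.span_diff subsetD)
  have "qvs.span (insert b B) \<subseteq> qvs.span (bvec ` S)"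
    using insert.prems(1) by (intro qvs.span_minimal) auto
  then have "Poly_Mapping.keys d \<subseteq> S"
    using d by (auto simp: span_bvec)
  then have dd: "d = 0" if "wform \<omega> d d = 0"
    using wform_pos[OF _ that] \<omega> by blast
  let ?u = "u + qscale t d"
  have "wform \<omega> x (v - ?u) = 0" if x: "x \<in> qvs.span (insert b B)" for x
  proof -
    \<comment> \<open>Since \<open>b = d + p\<close>, any \<open>x\<close> in the larger span can be
      written as \<open>y + qscale k d\<close> with \<open>y\<close> in \<open>span B\<close>, and
      this \<open>y\<close> is orthogonal to \<open>d\<close>.\<close>
    obtain k where "x - qscale k b \<in> qvs.span B"
      using x by (auto simp: qvs.span_breakdown_eq)
    then have "x - qscale k b + qscale k p \<in> qvs.span B"
      using p by (intro qvs.span_add qvs.span_scale)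
    moreover have "x - qscale k b + qscale k p = x - qscale k d"
      by (simp add: d_def qvs.scale_right_diff_distrib)
    ultimately obtain y where y: "y \<in> qvs.span B" "x = y + qscale k d"
      by (metis diff_add_cancel)
    have yd: "wform \<omega> y d = 0"
      using p(2)[OF y(1)] by (simp add: d_def)
    have "v - ?u = (v - u) - qscale t d" by simp
    then have 1: "wform \<omega> z (v - ?u) = wform \<omega> z (v - u) - t * wform \<omega> z d" for z
      by (metis wform_diff_right wform_scale_right)
    have 2: "wform \<omega> x z = wform \<omega> y z + k * wform \<omega> d z" for z
      using y(2) by (metis wform_add_right wform_scale_right wform_commute)
    have "wform \<omega> x (v - ?u)
        = wform \<omega> y (v - u) - t * wform \<omega> y d + k * (wform \<omega> d (v - u) - t * wform \<omega> d d)"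
      unfolding 1 2 by (simp only: algebra_simps)
    also have "\<dots> = k * (wform \<omega> d (v - u) - t * wform \<omega> d d)"
      using u(2)[OF y(1)] yd by simp
    also have "\<dots> = 0"
      using dd by (cases "wform \<omega> d d = 0") (auto simp: t_def wform_commute[of \<omega> 0])
    finally show ?thesis .
  qed
  moreover have "?u \<in> qvs.span (insert b B)"
    using u(1) sub d by (intro qvs.span_add qvs.span_scale) auto
  ultimately show ?case by blast
qed

text \<open>Projection shows that \<open>U\<close> and its complement together give the whole space,
  and positivity shows that they meet in zero. The dimension formula does the rest.\<close>

lemma dim_orthogonal_complement:
  assumes S: "finite S" "\<And>b. b \<in> S \<Longrightarrow> \<omega> b > 0"
    and U: "qvs.subspace U" "U \<subseteq> qvs.span (bvec ` S)"
  shows "qvs.dim U + qvs.dim {v \<in> qvs.span (bvec ` S). \<forall>u \<in> U. wform \<omega> u v = 0} = card S"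
proof -
  let ?V = "qvs.span (bvec ` S)"
  let ?W = "{v \<in> ?V. \<forall>u \<in> U. wform \<omega> u v = 0}"
  have W: "qvs.subspace ?W"
    by (rule qvs.subspaceI)
      (auto simp: wform_add_right wform_scale_right qvs.span_add qvs.span_scale qvs.span_zero)
  obtain B where B: "B \<subseteq> U" "qvs.independent B" "U \<subseteq> qvs.span B"
    using qvs.maximal_independent_subset by blast
  have "finite B"
    using qvs.independent_span_bound[of "bvec ` S" B] S(1) B U by auto
  moreover have "qvs.span B = U"
    using B U by (intro qvs.span_subspace)
  ultimately have proj: "\<exists>u \<in> U. \<forall>b \<in> U. wform \<omega> b (v - u) = 0" if "v \<in> ?V" for v
    using orthogonal_projection_exists[of S \<omega> B v] S that B U by auto
  have "\<exists>x y. v = x + y \<and> x \<in> U \<and> y \<in> ?W" if v: "v \<in> ?V" for v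
  proof -
    obtain u where u: "u \<in> U" "\<forall>b \<in> U. wform \<omega> b (v - u) = 0"
      using proj[OF v] by blast
    then have "v - u \<in> ?W"
      using v U by (auto intro: qvs.span_diff)
    then show ?thesis
      using u(1) by (intro exI[of _ u] exI[of _ "v - u"]) simp
  qed
  moreover have "x + y \<in> ?V" if "x \<in> U" "y \<in> ?W" for x y
    using that U by (auto intro: qvs.span_add)
  ultimately have sum: "{x + y | x y. x \<in> U \<and> y \<in> ?W} = ?V"
    by blast
  have "v = 0" if "v \<in> U" "v \<in> ?W" for v
  proof (rule wform_pos)
    show "wform \<omega> v v = 0" using that by blast
    show "\<omega> b > 0" if "b \<in> Poly_Mapping.keys v" for b
      using that S(2) \<open>v \<in> U\<close> U(2) by (auto simp: span_bvec)
  qed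
  then have "U \<inter> ?W \<subseteq> {0}" by blast
  then have "qvs.dim (U \<inter> ?W) = 0"
    using qvs.dim_le_card[of "U \<inter> ?W" "{}"] by simp
  moreover have "qvs.dim {x + y | x y. x \<in> U \<and> y \<in> ?W} + qvs.dim (U \<inter> ?W) = qvs.dim U + qvs.dim ?W"
    using S(1) U W by (intro qvs.dim_sums_Int_finite_span[of _ _ "bvec ` S"]) auto
  ultimately show ?thesis
    using sum dim_span_bvec[of S] by simp
qed

section \<open>Counting morphisms in exact categories\<close>

lemma ex1_mem_iff: "(\<exists>!x. x \<in> S) \<longleftrightarrow> (\<exists>x. S = {x})"
  by auto

context category
begin

lemma homs_obj:
  assumes "f \<in> homs C A B"
  shows "A \<in> obj C" "B \<in> obj C"
  using assms arr_ends by (auto simp: homs_def)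

lemma cmp_idt_right: "f \<in> homs C A B \<Longrightarrow> f \<star> idt C A = f"
  and cmp_idt_left: "f \<in> homs C A B \<Longrightarrow> idt C B \<star> f = f"
  using cmp_idt by blast+

lemma isos_hom: "f \<in> isos C A B \<Longrightarrow> f \<in> homs C A B"
  by (simp add: isos_def)

lemma isos_obtain_inverse:
  assumes "f \<in> isos C A B"
  obtains g where "g \<in> isos C B A" "g \<star> f = idt C A" "f \<star> g = idt C B"
  using assms by (auto simp: isos_def)

lemma idt_isos: "A \<in> obj C \<Longrightarrow> idt C A \<in> isos C A A"
  using idt_hom[of A] cmp_idt[of "idt C A" A A] by (auto simp: isos_def)

lemma isos_cmp:
  assumes "f \<in> isos C A B" "g \<in> isos C B D"
  shows "g \<star> f \<in> isos C A D"
proof -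
  obtain f' where f': "f' \<in> isos C B A" "f' \<star> f = idt C A" "f \<star> f' = idt C B"
    using assms(1) by (rule isos_obtain_inverse)
  obtain g' where g': "g' \<in> isos C D B" "g' \<star> g = idt C B" "g \<star> g' = idt C D"
    using assms(2) by (rule isos_obtain_inverse)
  note h = assms[THEN isos_hom] f'(1)[THEN isos_hom] g'(1)[THEN isos_hom]
  have "(f' \<star> g') \<star> (g \<star> f) = f' \<star> ((g' \<star> g) \<star> f)"
    using cmp_assoc[OF cmp_hom[OF h(1,2)] h(4,3)] cmp_assoc[OF h(1,2,4)] by simp
  then have 1: "(f' \<star> g') \<star> (g \<star> f) = idt C A"
    using f' g' cmp_idt_left[OF h(1)] by simp
  have "(g \<star> f) \<star> (f' \<star> g') = g \<star> ((f \<star> f') \<star> g')"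
    using cmp_assoc[OF cmp_hom[OF h(4,3)] h(1,2)] cmp_assoc[OF h(4,3,1)] by simp
  then have 2: "(g \<star> f) \<star> (f' \<star> g') = idt C D"
    using f' g' cmp_idt_left[OF h(4)] by simp
  show ?thesis
    using 1 2 cmp_hom[OF h(1,2)] cmp_hom[OF h(4,3)] by (auto simp: isos_def)
qed

lemma iso_class_eqI:
  assumes "f \<in> isos C X Y"
  shows "iso_class C X = iso_class C Y"
proof -
  obtain g where "g \<in> isos C Y X"
    using assms by (rule isos_obtain_inverse)
  then show ?thesis
    using assms isos_cmp unfolding iso_class_def by blast
qed

lemma iso_class_self: "X \<in> obj C \<Longrightarrow> X \<in> iso_class C X"
  using idt_isos unfolding iso_class_def by blast

lemma iso_class_eqD:
  assumes "X \<in> obj C" "Y \<in> obj C" "iso_class C X = iso_class C Y"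
  shows "isos C X Y \<noteq> {}"
  using iso_class_self[OF assms(2)] assms(3) unfolding iso_class_def by auto

lemma rep_iso_class:
  assumes "X \<in> obj C"
  shows "rep (iso_class C X) \<in> iso_class C X"
  using someI[of "\<lambda>Y. Y \<in> iso_class C X", OF iso_class_self[OF assms]] by (simp add: rep_def)

lemma Iso_rep:
  assumes "a \<in> Iso C"
  shows "rep a \<in> obj C" "iso_class C (rep a) = a"
proof -
  obtain X where X: "X \<in> obj C" "a = iso_class C X"
    using assms by (auto simp: Iso_def)
  show "rep a \<in> obj C"
    using rep_iso_class[OF X(1)] X by (simp add: iso_class_def)
  obtain f where "f \<in> isos C X (rep a)"
    using rep_iso_class[OF X(1)] X by (auto simp: iso_class_def)
  then show "iso_class C (rep a) = a"
    using iso_class_eqI X by metis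
qed

lemma iso_class_Iso: "X \<in> obj C \<Longrightarrow> iso_class C X \<in> Iso C"
  by (simp add: Iso_def)

lemma isos_rep: "X \<in> obj C \<Longrightarrow> isos C (rep (iso_class C X)) X \<noteq> {}"
  by (intro iso_class_eqD) (simp_all add: Iso_rep iso_class_Iso)

lemma is_zero_object_iff:
  "is_zero_object C Z \<longleftrightarrow>
    Z \<in> obj C \<and> (\<forall>A \<in> obj C. (\<exists>u. homs C A Z = {u}) \<and> (\<exists>v. homs C Z A = {v}))"
  unfolding is_zero_object_def ex1_mem_iff ..

lemma is_zero_object_isos:
  assumes "is_zero_object C Z" "f \<in> isos C Z Y"
  shows "is_zero_object C Y"
proof -
  obtain g where g: "g \<in> isos C Y Z" "g \<star> f = idt C Z" "f \<star> g = idt C Y"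
    using assms(2) by (rule isos_obtain_inverse)
  note h = assms(2)[THEN isos_hom] g(1)[THEN isos_hom]
  show ?thesis
    unfolding is_zero_object_def
  proof (intro conjI ballI)
    show "Y \<in> obj C" using h homs_obj by blast
    fix A assume A: "A \<in> obj C"
    obtain u v where "homs C A Z = {u}" "homs C Z A = {v}"
      using assms(1) A by (auto simp: is_zero_object_iff)
    then have u: "u \<in> homs C A Z" "\<And>u'. u' \<in> homs C A Z \<Longrightarrow> u' = u"
      and v: "v \<in> homs C Z A" "\<And>v'. v' \<in> homs C Z A \<Longrightarrow> v' = v"
      by auto
    show "\<exists>!x. x \<in> homs C A Y"
    proof (rule ex1I[of _ "f \<star> u"])
      show "f \<star> u \<in> homs C A Y" using u(1) h(1) by (rule cmp_hom)
      fix x assume x: "x \<in> homs C A Y"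
      have "x = f \<star> (g \<star> x)"
        using cmp_assoc[OF x h(2,1)] g(3) cmp_idt_left[OF x] by simp
      also have "g \<star> x = u" by (rule u(2)[OF cmp_hom[OF x h(2)]])
      finally show "x = f \<star> u" .
    qed
    show "\<exists>!x. x \<in> homs C Y A"
    proof (rule ex1I[of _ "v \<star> g"])
      show "v \<star> g \<in> homs C Y A" using h(2) v(1) by (rule cmp_hom)
      fix x assume x: "x \<in> homs C Y A"
      have "x = (x \<star> f) \<star> g"
        using cmp_assoc[OF h(2,1) x] g(3) cmp_idt_right[OF x] by simp
      also have "x \<star> f = v" by (rule v(2)[OF cmp_hom[OF h(1) x]])
      finally show "x = v \<star> g" .
    qed
  qed
qed

lemma zero_objects_isos:
  assumes "is_zero_object C Z" "is_zero_object C Y"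
  shows "isos C Z Y \<noteq> {}"
proof -
  have obj: "Z \<in> obj C" "Y \<in> obj C"
    using assms by (simp_all add: is_zero_object_def)
  obtain f g e e' where fg: "homs C Z Y = {f}" "homs C Y Z = {g}"
    and e: "homs C Z Z = {e}" "homs C Y Y = {e'}"
    using assms obj by (metis is_zero_object_iff)
  have "g \<star> f = idt C Z" "f \<star> g = idt C Y"
    using cmp_hom[of f Z Y g Z] cmp_hom[of g Y Z f Y] idt_hom[OF obj(1)] idt_hom[OF obj(2)] fg e by simp_all
  then show ?thesis
    using fg by (auto simp: isos_def)
qed

text \<open>Links the choice-free class [0] to the class of any particular zero object: zero objects
  are isomorphic to each other, and being zero is invariant under isomorphism.\<close>

lemma zero_iso_class_eq:
  assumes "is_zero_object C Z"
  shows "zero_iso_class C = iso_class C Z"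
proof -
  have "is_zero_object C Y \<longleftrightarrow> Y \<in> obj C \<and> isos C Z Y \<noteq> {}" for Y
    using zero_objects_isos[OF assms, of Y] is_zero_object_isos[OF assms, of _ Y] is_zero_object_iff[of Y]
    by blast
  then show ?thesis
    by (simp add: zero_iso_class_def iso_class_def)
qed

lemma zero_object_iff_iso_class:
  assumes "X \<in> obj C"
  shows "is_zero_object C X \<longleftrightarrow> iso_class C X = zero_iso_class C"
  using assms zero_iso_class_eq iso_class_self[OF assms] by (auto simp: zero_iso_class_def)

end

section \<open>Hom groups and biproducts\<close>

context additive_category
begin

text \<open>The group laws of \<open>hom_group\<close> restated for the raw operations. The record
  carries no negation, so differences are reached through \<open>msub_ex\<close>, and cancellation
  takes the form \<open>madd_eq_self\<close>.\<close>

lemma zmor_hom: "A \<in> obj C \<Longrightarrow> B \<in> obj C \<Longrightarrow> zmor C A B \<in> homs C A B"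
  and madd_hom: "f \<in> homs C A B \<Longrightarrow> g \<in> homs C A B \<Longrightarrow> f \<boxplus> g \<in> homs C A B"
  and madd_commute: "f \<in> homs C A B \<Longrightarrow> g \<in> homs C A B \<Longrightarrow> f \<boxplus> g = g \<boxplus> f"
  and madd_zmor: "f \<in> homs C A B \<Longrightarrow> f \<boxplus> zmor C A B = f"
  and madd_eq_self: "f \<in> homs C A B \<Longrightarrow> f \<boxplus> g = f \<Longrightarrow> g \<in> homs C A B \<Longrightarrow>
    g = zmor C A B"
  and msub_ex: "f \<in> homs C A B \<Longrightarrow> g \<in> homs C A B \<Longrightarrow> \<exists>d \<in> homs C A B. f = g \<boxplus> d"
proof -
  have G: "comm_group (hom_group C A B)" if "f \<in> homs C A B" for f
    using homs_obj[OF that] by (rule hom_comm_group)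
  have G0: "comm_group (hom_group C A B)" if "A \<in> obj C" "B \<in> obj C"
    using that by (rule hom_comm_group)
  show "A \<in> obj C \<Longrightarrow> B \<in> obj C \<Longrightarrow> zmor C A B \<in> homs C A B"
    using monoid.one_closed[of "hom_group C A B"] G0
    by (simp add: hom_group_def comm_group_def comm_monoid_def)
  show "f \<in> homs C A B \<Longrightarrow> g \<in> homs C A B \<Longrightarrow> f \<boxplus> g \<in> homs C A B"
    using monoid.m_closed[of "hom_group C A B"] G
    by (simp add: hom_group_def comm_group_def comm_monoid_def)
  show "f \<in> homs C A B \<Longrightarrow> g \<in> homs C A B \<Longrightarrow> f \<boxplus> g = g \<boxplus> f"
    using comm_monoid.m_comm[of "hom_group C A B" f g] G
    by (simp add: hom_group_def comm_group_def)
  show "f \<in> homs C A B \<Longrightarrow> f \<boxplus> zmor C A B = f"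
    using monoid.r_one[of "hom_group C A B" f] G
    by (simp add: hom_group_def comm_group_def comm_monoid_def)
  show "f \<in> homs C A B \<Longrightarrow> f \<boxplus> g = f \<Longrightarrow> g \<in> homs C A B \<Longrightarrow> g = zmor C A B"
    using group.l_cancel_one[of "hom_group C A B" f g] G
    by (simp add: hom_group_def comm_group_def)
  show "\<exists>d \<in> homs C A B. f = g \<boxplus> d" if "f \<in> homs C A B" "g \<in> homs C A B"
  proof -
    interpret comm_group "hom_group C A B" using that(1) by (rule G)
    let ?d = "inv\<^bsub>hom_group C A B\<^esub> g \<otimes>\<^bsub>hom_group C A B\<^esub> f"
    have "f \<in> carrier (hom_group C A B)" "g \<in> carrier (hom_group C A B)"
      using that by (simp_all add: hom_group_def)
    then have "?d \<in> carrier (hom_group C A B)" "f = g \<otimes>\<^bsub>hom_group C A B\<^esub> ?d"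
      by (simp_all add: m_assoc[symmetric])
    then show ?thesis by (auto simp: hom_group_def)
  qed
qed

text \<open>By bilinearity the composite is equal to its own double, so cancellation makes it
  zero.\<close>

lemma cmp_zmor_right:
  assumes "g \<in> homs C B D" "A \<in> obj C"
  shows "g \<star> zmor C A B = zmor C A D"
proof -
  have z: "zmor C A B \<in> homs C A B"
    using zmor_hom[OF assms(2) homs_obj(1)[OF assms(1)]] .
  then have "(g \<star> zmor C A B) \<boxplus> (g \<star> zmor C A B) = g \<star> zmor C A B"
    using cmp_madd_right[OF z z assms(1)] madd_zmor[OF z] by simp
  then show ?thesis
    using madd_eq_self[OF cmp_hom[OF z assms(1)] _ cmp_hom[OF z assms(1)]] by simp
qed

lemma cmp_zmor_left:
  assumes "f \<in> homs C A B" "D \<in> obj C"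
  shows "zmor C B D \<star> f = zmor C A D"
proof -
  have z: "zmor C B D \<in> homs C B D"
    using zmor_hom[OF homs_obj(2)[OF assms(1)] assms(2)] .
  then have "(zmor C B D \<star> f) \<boxplus> (zmor C B D \<star> f) = zmor C B D \<star> f"
    using cmp_madd_left[OF assms(1) z z] madd_zmor[OF z] by simp
  then show ?thesis
    using madd_eq_self[OF cmp_hom[OF assms(1) z] _ cmp_hom[OF assms(1) z]] by simp
qed

lemma homs_zero_object:
  assumes "is_zero_object C Z" "A \<in> obj C"
  shows "homs C Z A = {zmor C Z A}" "homs C A Z = {zmor C A Z}"
proof -
  have Z: "Z \<in> obj C" and "\<exists>u. homs C Z A = {u}" "\<exists>v. homs C A Z = {v}"
    using assms by (simp_all add: is_zero_object_iff)
  then show "homs C Z A = {zmor C Z A}" "homs C A Z = {zmor C A Z}"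
    using zmor_hom[OF Z assms(2)] zmor_hom[OF assms(2) Z] by auto
qed

lemma madd_zmor_left: "f \<in> homs C A B \<Longrightarrow> zmor C A B \<boxplus> f = f"
  using madd_commute[of f A B "zmor C A B"] madd_zmor[of f A B] zmor_hom homs_obj[of f A B] by simp

lemma is_biproduct_commute:
  assumes "is_biproduct C A B S i j p q"
  shows "is_biproduct C B A S j i q p"
proof -
  have h: "i \<in> homs C A S" "j \<in> homs C B S" "p \<in> homs C S A" "q \<in> homs C S B"
    using assms by (simp_all add: is_biproduct_def)
  show ?thesis
    using assms madd_commute[OF cmp_hom[OF h(3,1)] cmp_hom[OF h(4,2)]] by (simp add: is_biproduct_def)
qed

text \<open>Through \<open>confl_split\<close> this provides the short exact sequences with a zero
  end.\<close>

lemma is_biproduct_zero: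
  assumes "is_zero_object C Z" "X \<in> obj C"
  shows "is_biproduct C Z X X (zmor C Z X) (idt C X) (zmor C X Z) (idt C X)"
proof -
  have Z: "Z \<in> obj C" using assms(1) by (simp add: is_zero_object_def)
  note h = zmor_hom[OF Z assms(2)] zmor_hom[OF assms(2) Z] idt_hom[OF assms(2)] idt_hom[OF Z]
  have "zmor C X Z \<star> zmor C Z X = idt C Z"
    using homs_zero_object[OF assms(1) Z] cmp_hom[OF h(1,2)] h(4) by simp
  moreover have "zmor C Z X \<star> zmor C X Z = zmor C X X"
    using cmp_zmor_right[OF h(1) assms(2)] .
  ultimately show ?thesis
    unfolding is_biproduct_def
    using h assms by (simp add: cmp_idt_left cmp_idt_right madd_zmor_left)
qed

text \<open>Direct sums are unique up to isomorphism: \<open>i'p + j'q\<close> and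
  \<open>ip' + jq'\<close> are mutually inverse.\<close>

lemma is_biproduct_isos:
  assumes "is_biproduct C A B S i j p q" "is_biproduct C A B S' i' j' p' q'"
  shows "isos C S S' \<noteq> {}"
proof -
  \<comment> \<open>Multiplication of a row \<open>(k, l)\<close> by a column
    \<open>(p', q')\<close> through the intermediate direct sum. Instantiated once for
    \<open>S\<close> and once for \<open>S'\<close>, it gives both composites.\<close>
  have *: "((k \<star> p) \<boxplus> (l \<star> q)) \<star> ((i \<star> p') \<boxplus> (j \<star> q')) = (k \<star> p') \<boxplus> (l \<star> q')"
    if "is_biproduct C A B S i j p q" "p' \<in> homs C T A" "q' \<in> homs C T B"
      "k \<in> homs C A R" "l \<in> homs C B R" for i j p q p' q' k l S T R
  proof -
    have b: "i \<in> homs C A S" "j \<in> homs C B S" "p \<in> homs C S A" "q \<in> homs C S B"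
      "p \<star> i = idt C A" "q \<star> j = idt C B" "p \<star> j = zmor C B A" "q \<star> i = zmor C A B"
      using that(1) unfolding is_biproduct_def by blast+
    note h = b(1-4) that(2-5)
    let ?u = "(k \<star> p) \<boxplus> (l \<star> q)"
    have u: "k \<star> p \<in> homs C S R" "l \<star> q \<in> homs C S R" "?u \<in> homs C S R"
      using cmp_hom[OF h(3,7)] cmp_hom[OF h(4,8)]
        madd_hom[OF cmp_hom[OF h(3,7)] cmp_hom[OF h(4,8)]] by simp_all
    have "?u \<star> i = ((k \<star> p) \<star> i) \<boxplus> ((l \<star> q) \<star> i)"
      by (rule cmp_madd_left[OF h(1) u(1,2)])
    also have "(k \<star> p) \<star> i = k"
      using cmp_assoc[OF h(1,3,7)] b(5) cmp_idt_right[OF h(7)] by simp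
    also have "(l \<star> q) \<star> i = zmor C A R"
      using cmp_assoc[OF h(1,4,8)] b(8) cmp_zmor_right[OF h(8) homs_obj(1)[OF h(1)]] by simp
    also have "k \<boxplus> zmor C A R = k"
      by (rule madd_zmor[OF h(7)])
    finally have ui: "?u \<star> i = k" .
    have "?u \<star> j = ((k \<star> p) \<star> j) \<boxplus> ((l \<star> q) \<star> j)"
      by (rule cmp_madd_left[OF h(2) u(1,2)])
    also have "(k \<star> p) \<star> j = zmor C B R"
      using cmp_assoc[OF h(2,3,7)] b(7) cmp_zmor_right[OF h(7) homs_obj(1)[OF h(2)]] by simp
    also have "(l \<star> q) \<star> j = l"
      using cmp_assoc[OF h(2,4,8)] b(6) cmp_idt_right[OF h(8)] by simp
    also have "zmor C B R \<boxplus> l = l"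
      by (rule madd_zmor_left[OF h(8)])
    finally have uj: "?u \<star> j = l" .
    have ip: "i \<star> p' \<in> homs C T S" "j \<star> q' \<in> homs C T S"
      using cmp_hom[OF h(5,1)] cmp_hom[OF h(6,2)] by simp_all
    then have "?u \<star> ((i \<star> p') \<boxplus> (j \<star> q')) = (?u \<star> (i \<star> p')) \<boxplus> (?u \<star> (j \<star> q'))"
      by (rule cmp_madd_right[OF _ _ u(3)])
    also have "?u \<star> (i \<star> p') = k \<star> p'"
      using ui cmp_assoc[OF h(5,1) u(3)] by simp
    also have "?u \<star> (j \<star> q') = l \<star> q'"
      using uj cmp_assoc[OF h(6,2) u(3)] by simp
    finally show ?thesis .
  qed
  have h: "i \<in> homs C A S" "j \<in> homs C B S" "p \<in> homs C S A" "q \<in> homs C S B"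
      "(i \<star> p) \<boxplus> (j \<star> q) = idt C S"
      "i' \<in> homs C A S'" "j' \<in> homs C B S'" "p' \<in> homs C S' A" "q' \<in> homs C S' B"
      "(i' \<star> p') \<boxplus> (j' \<star> q') = idt C S'"
    using assms unfolding is_biproduct_def by blast+
  let ?f = "(i' \<star> p) \<boxplus> (j' \<star> q)" and ?g = "(i \<star> p') \<boxplus> (j \<star> q')"
  have "?f \<in> homs C S S'" "?g \<in> homs C S' S"
    using madd_hom[OF cmp_hom[OF h(3,6)] cmp_hom[OF h(4,7)]]
      madd_hom[OF cmp_hom[OF h(8,1)] cmp_hom[OF h(9,2)]] by simp_all
  moreover have "?g \<star> ?f = idt C S" "?f \<star> ?g = idt C S'"
    using *[OF assms(2) h(3,4) h(1,2)] *[OF assms(1) h(8,9) h(6,7)] h by simp_all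
  ultimately have "?f \<in> isos C S S'"
    unfolding isos_def by blast
  then show ?thesis by blast
qed

text \<open>A pair \<open>(u, v)\<close> is recovered from \<open>iu + jv\<close> by composing with
  \<open>p\<close> and \<open>q\<close>, and dually with \<open>i\<close> and \<open>j\<close>.
  These lower bounds are compared with the upper bounds for an arbitrary middle term in
  \<open>card_homs_to_ses\<close> and \<open>card_homs_from_ses\<close>.\<close>

lemma card_homs_direct_sum:
  assumes fin: "hom_finite C" and S: "is_direct_sum C A B S" and T: "T \<in> obj C"
  shows "card (homs C T A) * card (homs C T B) \<le> card (homs C T S)"
    and "card (homs C A T) * card (homs C B T) \<le> card (homs C S T)"
proof -
  obtain i j p q where "is_biproduct C A B S i j p q" and obj: "S \<in> obj C" "A \<in> obj C" "B \<in> obj C"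
    using S by (auto simp: is_direct_sum_def)
  then have b: "i \<in> homs C A S" "j \<in> homs C B S" "p \<in> homs C S A" "q \<in> homs C S B"
      "p \<star> i = idt C A" "q \<star> j = idt C B" "p \<star> j = zmor C B A" "q \<star> i = zmor C A B"
    unfolding is_biproduct_def by blast+
  let ?F = "\<lambda>(u, v). (i \<star> u) \<boxplus> (j \<star> v)"
  have F: "(i \<star> u) \<boxplus> (j \<star> v) \<in> homs C T S \<and>
      p \<star> ((i \<star> u) \<boxplus> (j \<star> v)) = u \<and> q \<star> ((i \<star> u) \<boxplus> (j \<star> v)) = v"
    if "u \<in> homs C T A" "v \<in> homs C T B" for u v
  proof -
    have iu: "i \<star> u \<in> homs C T S" "j \<star> v \<in> homs C T S"
      using cmp_hom[OF that(1) b(1)] cmp_hom[OF that(2) b(2)] by simp_all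
    have "p \<star> ((i \<star> u) \<boxplus> (j \<star> v)) = (p \<star> (i \<star> u)) \<boxplus> (p \<star> (j \<star> v))"
      by (rule cmp_madd_right[OF iu b(3)])
    also have "p \<star> (i \<star> u) = u"
      using cmp_assoc[OF that(1) b(1,3)] b(5) cmp_idt_left[OF that(1)] by simp
    also have "p \<star> (j \<star> v) = zmor C T A"
      using cmp_assoc[OF that(2) b(2,3)] b(7) cmp_zmor_left[OF that(2) obj(2)] by simp
    also have "u \<boxplus> zmor C T A = u"
      by (rule madd_zmor[OF that(1)])
    finally have 1: "p \<star> ((i \<star> u) \<boxplus> (j \<star> v)) = u" .
    have "q \<star> ((i \<star> u) \<boxplus> (j \<star> v)) = (q \<star> (i \<star> u)) \<boxplus> (q \<star> (j \<star> v))"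
      by (rule cmp_madd_right[OF iu b(4)])
    also have "q \<star> (i \<star> u) = zmor C T B"
      using cmp_assoc[OF that(1) b(1,4)] b(8) cmp_zmor_left[OF that(1) obj(3)] by simp
    also have "q \<star> (j \<star> v) = v"
      using cmp_assoc[OF that(2) b(2,4)] b(6) cmp_idt_left[OF that(2)] by simp
    also have "zmor C T B \<boxplus> v = v"
      by (rule madd_zmor_left[OF that(2)])
    finally show ?thesis
      using 1 madd_hom[OF iu] by simp
  qed
  have "inj_on ?F (homs C T A \<times> homs C T B)"
  proof (rule inj_onI, clarify)
    fix u v u' v'
    assume "u \<in> homs C T A" "v \<in> homs C T B" "u' \<in> homs C T A" "v' \<in> homs C T B"
      "(i \<star> u) \<boxplus> (j \<star> v) = (i \<star> u') \<boxplus> (j \<star> v')"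
    then show "u = u' \<and> v = v'" using F by metis
  qed
  then have "card (homs C T A \<times> homs C T B) \<le> card (homs C T S)"
    using F fin T obj by (intro card_inj_on_le[of ?F]) (auto simp: hom_finite_def)
  then show "card (homs C T A) * card (homs C T B) \<le> card (homs C T S)"
    by (simp add: card_cartesian_product)
  let ?G = "\<lambda>(u, v). (u \<star> p) \<boxplus> (v \<star> q)"
  have G: "(u \<star> p) \<boxplus> (v \<star> q) \<in> homs C S T \<and>
      ((u \<star> p) \<boxplus> (v \<star> q)) \<star> i = u \<and> ((u \<star> p) \<boxplus> (v \<star> q)) \<star> j = v"
    if "u \<in> homs C A T" "v \<in> homs C B T" for u v
  proof -
    have up: "u \<star> p \<in> homs C S T" "v \<star> q \<in> homs C S T"
      using cmp_hom[OF b(3) that(1)] cmp_hom[OF b(4) that(2)] by simp_all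
    have "((u \<star> p) \<boxplus> (v \<star> q)) \<star> i = ((u \<star> p) \<star> i) \<boxplus> ((v \<star> q) \<star> i)"
      by (rule cmp_madd_left[OF b(1) up])
    also have "(u \<star> p) \<star> i = u"
      using cmp_assoc[OF b(1,3) that(1)] b(5) cmp_idt_right[OF that(1)] by simp
    also have "(v \<star> q) \<star> i = zmor C A T"
      using cmp_assoc[OF b(1,4) that(2)] b(8) cmp_zmor_right[OF that(2) obj(2)] by simp
    also have "u \<boxplus> zmor C A T = u"
      by (rule madd_zmor[OF that(1)])
    finally have 1: "((u \<star> p) \<boxplus> (v \<star> q)) \<star> i = u" .
    have "((u \<star> p) \<boxplus> (v \<star> q)) \<star> j = ((u \<star> p) \<star> j) \<boxplus> ((v \<star> q) \<star> j)"
      by (rule cmp_madd_left[OF b(2) up])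
    also have "(u \<star> p) \<star> j = zmor C B T"
      using cmp_assoc[OF b(2,3) that(1)] b(7) cmp_zmor_right[OF that(1) obj(3)] by simp
    also have "(v \<star> q) \<star> j = v"
      using cmp_assoc[OF b(2,4) that(2)] b(6) cmp_idt_right[OF that(2)] by simp
    also have "zmor C B T \<boxplus> v = v"
      by (rule madd_zmor_left[OF that(2)])
    finally show ?thesis
      using 1 madd_hom[OF up] by simp
  qed
  have "inj_on ?G (homs C A T \<times> homs C B T)"
  proof (rule inj_onI, clarify)
    fix u v u' v'
    assume "u \<in> homs C A T" "v \<in> homs C B T" "u' \<in> homs C A T" "v' \<in> homs C B T"
      "(u \<star> p) \<boxplus> (v \<star> q) = (u' \<star> p) \<boxplus> (v' \<star> q)"
    then show "u = u' \<and> v = v'" using G by metis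
  qed
  then have "card (homs C A T \<times> homs C B T) \<le> card (homs C S T)"
    using G fin T obj by (intro card_inj_on_le[of ?G]) (auto simp: hom_finite_def)
  then show "card (homs C A T) * card (homs C B T) \<le> card (homs C S T)"
    by (simp add: card_cartesian_product)
qed

end

section \<open>Short exact sequences and the size of Hom sets of their middle terms\<close>

context exact_category
begin

lemma ses_homs:
  assumes "(i, p) \<in> ses C A B X"
  shows "i \<in> homs C B X" "p \<in> homs C X A" "p \<star> i = zmor C B A"
  using assms confl_kernel_cokernel by (auto simp: ses_def is_kernel_def homs_def)

lemma ses_kernel:
  assumes "(i, p) \<in> ses C A B X" "g \<in> homs C T X" "p \<star> g = zmor C T A"
  shows "\<exists>!h. h \<in> homs C T B \<and> i \<star> h = g"
proof -
  have "is_kernel C i p" "src C p = X" "tgt C p = A" "src C i = B"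
    using assms(1) confl_kernel_cokernel by (auto simp: ses_def homs_def)
  then show ?thesis
    using assms(2,3) homs_obj[OF assms(2)] unfolding is_kernel_def by blast
qed

lemma ses_cokernel:
  assumes "(i, p) \<in> ses C A B X" "g \<in> homs C X T" "g \<star> i = zmor C B T"
  shows "\<exists>!h. h \<in> homs C A T \<and> h \<star> p = g"
proof -
  have "is_cokernel C p i" "tgt C i = X" "tgt C p = A" "src C i = B"
    using assms(1) confl_kernel_cokernel by (auto simp: ses_def homs_def)
  then show ?thesis
    using assms(2,3) homs_obj[OF assms(2)] unfolding is_cokernel_def by blast
qed

text \<open>Both maps are lifts of one and the same map killed by \<open>p\<close>, and lifts
  through a kernel are unique.\<close>

lemma ses_mono:
  assumes "(i, p) \<in> ses C A B X" "h \<in> homs C T B" "h' \<in> homs C T B" "i \<star> h = i \<star> h'"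
  shows "h = h'"
proof -
  note ip = ses_homs[OF assms(1)]
  have "p \<star> (i \<star> h) = zmor C T A"
    using cmp_assoc[OF assms(2) ip(1,2)] ip(3) cmp_zmor_left[OF assms(2) homs_obj(2)[OF ip(2)]] by simp
  then show ?thesis
    using ses_kernel[OF assms(1) cmp_hom[OF assms(2) ip(1)]] assms(2-4) by metis
qed

lemma ses_epi:
  assumes "(i, p) \<in> ses C A B X" "h \<in> homs C A T" "h' \<in> homs C A T" "h \<star> p = h' \<star> p"
  shows "h = h'"
proof -
  note ip = ses_homs[OF assms(1)]
  have "(h \<star> p) \<star> i = zmor C B T"
    using cmp_assoc[OF ip(1,2) assms(2)] ip(3) cmp_zmor_right[OF assms(2) homs_obj(1)[OF ip(1)]] by simp
  then show ?thesis
    using ses_cokernel[OF assms(1) cmp_hom[OF ip(2) assms(2)]] assms(2-4) by metis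
qed

text \<open>The splitting lemma. The difference \<open>d\<close> of the identity and
  \<open>s \<star> p\<close> is killed by \<open>p\<close>, so it factors as
  \<open>i \<star> r\<close>; this \<open>r\<close> is the missing projection onto \<open>B\<close>,
  and its relations are checked after composing with the monomorphism \<open>i\<close>.\<close>

lemma direct_sum_if_section:
  assumes ip: "(i, p) \<in> ses C A B X" and s: "s \<in> homs C A X" "p \<star> s = idt C A"
  shows "is_direct_sum C A B X"
proof -
  note h = ses_homs[OF ip]
  have obj: "A \<in> obj C" "B \<in> obj C" "X \<in> obj C"
    using h homs_obj by blast+
  have sp: "s \<star> p \<in> homs C X X" using h(2) s(1) by (rule cmp_hom)
  obtain d where d: "d \<in> homs C X X" "idt C X = (s \<star> p) \<boxplus> d"
    using msub_ex[OF idt_hom[OF obj(3)] sp] by blast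
  have psp: "p \<star> (s \<star> p) = p"
    using cmp_assoc[OF h(2) s(1) h(2)] s(2) cmp_idt_left[OF h(2)] by simp
  have "p = (p \<star> (s \<star> p)) \<boxplus> (p \<star> d)"
    using cmp_madd_right[OF sp d(1) h(2)] d(2) cmp_idt_right[OF h(2)] by simp
  then have "p \<star> d = zmor C X A"
    using psp madd_eq_self[OF h(2) _ cmp_hom[OF d(1) h(2)]] by simp
  then obtain r where r: "r \<in> homs C X B" "i \<star> r = d"
    using ses_kernel[OF ip d(1)] by blast
  have "d \<star> i = i"
  proof -
    have "i = ((s \<star> p) \<star> i) \<boxplus> (d \<star> i)"
      using cmp_madd_left[OF h(1) sp d(1)] d(2) cmp_idt_left[OF h(1)] by simp
    also have "(s \<star> p) \<star> i = zmor C B X"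
      using cmp_assoc[OF h(1,2) s(1)] h(3) cmp_zmor_right[OF s(1) obj(2)] by simp
    also have "zmor C B X \<boxplus> (d \<star> i) = d \<star> i"
      by (rule madd_zmor_left[OF cmp_hom[OF h(1) d(1)]])
    finally show ?thesis ..
  qed
  then have "i \<star> (r \<star> i) = i \<star> idt C B"
    using cmp_assoc[OF h(1) r(1) h(1)] r(2) cmp_idt_right[OF h(1)] by simp
  then have ri: "r \<star> i = idt C B"
    using ses_mono[OF ip cmp_hom[OF h(1) r(1)] idt_hom[OF obj(2)]] by simp
  have "d \<star> s = zmor C A X"
  proof -
    have "s = ((s \<star> p) \<star> s) \<boxplus> (d \<star> s)"
      using cmp_madd_left[OF s(1) sp d(1)] d(2) cmp_idt_left[OF s(1)] by simp
    moreover have "(s \<star> p) \<star> s = s"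
      using cmp_assoc[OF s(1) h(2) s(1)] s(2) cmp_idt_right[OF s(1)] by simp
    ultimately show ?thesis
      using madd_eq_self[OF s(1) _ cmp_hom[OF s(1) d(1)]] by simp
  qed
  then have "i \<star> (r \<star> s) = i \<star> zmor C A B"
    using cmp_assoc[OF s(1) r(1) h(1)] r(2) cmp_zmor_right[OF h(1) obj(1)] by simp
  then have "r \<star> s = zmor C A B"
    using ses_mono[OF ip cmp_hom[OF s(1) r(1)] zmor_hom[OF obj(1,2)]] by simp
  then have "is_biproduct C A B X s i p r"
    unfolding is_biproduct_def using h s r ri d by simp
  then show ?thesis
    unfolding is_direct_sum_def using obj by blast
qed

text \<open>The biproduct is commuted because \<open>ses C A B\<close> has \<open>B\<close> as the
  subobject, whereas \<open>confl_split\<close> takes the first summand for it.\<close>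

lemma ses_if_direct_sum:
  assumes "is_direct_sum C A B S"
  shows "ses C A B S \<noteq> {}"
proof -
  obtain i j p q where b: "is_biproduct C A B S i j p q" and obj: "A \<in> obj C" "B \<in> obj C" "S \<in> obj C"
    using assms by (auto simp: is_direct_sum_def)
  have "(j, p) \<in> confl C"
    using confl_split[OF obj(2,1,3) is_biproduct_commute[OF b]] .
  then have "(j, p) \<in> ses C A B S"
    using b by (simp add: ses_def is_biproduct_def)
  then show ?thesis by blast
qed

text \<open>Conjugating \<open>i\<close> and \<open>p\<close> by the given isomorphisms yields an
  isomorphic pair, which is again a conflation. So the existence of a sequence depends only on
  isomorphism classes.\<close>

lemma ses_isos:
  assumes ip: "(i, p) \<in> ses C A B X"
    and "isos C A A' \<noteq> {}" "isos C B B' \<noteq> {}" "isos C X X' \<noteq> {}"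
  shows "ses C A' B' X' \<noteq> {}"
proof -
  obtain a b x where abx: "a \<in> isos C A A'" "b \<in> isos C B B'" "x \<in> isos C X X'"
    using assms by blast
  obtain b' where b': "b' \<in> isos C B' B" "b' \<star> b = idt C B"
    using abx(2) by (rule isos_obtain_inverse)
  obtain x' where x': "x' \<in> isos C X' X" "x' \<star> x = idt C X"
    using abx(3) by (rule isos_obtain_inverse)
  note h = abx[THEN isos_hom] b'(1)[THEN isos_hom] x'(1)[THEN isos_hom] ses_homs(1,2)[OF ip]
  let ?i = "(x \<star> i) \<star> b'" and ?p = "(a \<star> p) \<star> x'"
  have xi: "x \<star> i \<in> homs C B X'" "a \<star> p \<in> homs C X A'"
    using cmp_hom[OF h(6,3)] cmp_hom[OF h(7,1)] by simp_all
  have hom: "?i \<in> homs C B' X'" "?p \<in> homs C X' A'"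
    using cmp_hom[OF h(4) xi(1)] cmp_hom[OF h(5) xi(2)] by simp_all
  have "x \<star> i = ?i \<star> b"
    using cmp_assoc[OF h(2,4) xi(1)] b'(2) cmp_idt_right[OF xi(1)] by simp
  moreover have "a \<star> p = ?p \<star> x"
    using cmp_assoc[OF h(3,5) xi(2)] x'(2) cmp_idt_right[OF xi(2)] by simp
  ultimately have "(?i, ?p) \<in> confl C"
    using confl_iso_closed[OF _ h(6,7) hom abx(2,3,1)] ip by (simp add: ses_def)
  then show ?thesis
    using hom unfolding ses_def by blast
qed

text \<open>Left exactness of Hom(T, -): two maps with the same composite with \<open>p\<close>
  differ by a map that factors through \<open>i\<close>. The image is kept in the bound because
  strictness will come from its being a proper subset of Hom(T, A).\<close>

lemma card_homs_to_ses:
  assumes fin: "hom_finite C" and ip: "(i, p) \<in> ses C A B X" and T: "T \<in> obj C"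
  shows "card (homs C T X) \<le> card ((\<lambda>f. p \<star> f) ` homs C T X) * card (homs C T B)"
proof -
  note h = ses_homs[OF ip]
  let ?I = "(\<lambda>f. p \<star> f) ` homs C T X"
  define s where "s = inv_into (homs C T X) (\<lambda>f. p \<star> f)"
  have finI: "finite (?I \<times> homs C T B)"
    using fin T homs_obj[OF h(1)] homs_obj[OF h(2)] by (simp add: hom_finite_def)
  have "homs C T X \<subseteq> (\<lambda>(a, b). s a \<boxplus> (i \<star> b)) ` (?I \<times> homs C T B)"
  proof
    fix f assume f: "f \<in> homs C T X"
    then have sf: "s (p \<star> f) \<in> homs C T X" "p \<star> s (p \<star> f) = p \<star> f"
      unfolding s_def by (simp_all add: inv_into_into f_inv_into_f)
    obtain d where d: "d \<in> homs C T X" "f = s (p \<star> f) \<boxplus> d"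
      using msub_ex[OF f sf(1)] by blast
    have "(p \<star> f) \<boxplus> (p \<star> d) = p \<star> f"
      using cmp_madd_right[OF sf(1) d(1) h(2)] d(2) sf(2) by simp
    then have "p \<star> d = zmor C T A"
      using madd_eq_self[OF cmp_hom[OF f h(2)] _ cmp_hom[OF d(1) h(2)]] by simp
    then obtain b where "b \<in> homs C T B" "i \<star> b = d"
      using ses_kernel[OF ip d(1)] by blast
    then show "f \<in> (\<lambda>(a, b). s a \<boxplus> (i \<star> b)) ` (?I \<times> homs C T B)"
      using d f by (intro image_eqI[of _ _ "(p \<star> f, b)"]) auto
  qed
  then have "card (homs C T X) \<le> card (?I \<times> homs C T B)"
    using finI by (rule surj_card_le[rotated])
  then show ?thesis by (simp add: card_cartesian_product)
qed

text \<open>The dual count, by left exactness of Hom(-, T); here the image in Hom(B, T) is simply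
  bounded by the whole set.\<close>

lemma card_homs_from_ses:
  assumes fin: "hom_finite C" and ip: "(i, p) \<in> ses C A B X" and T: "T \<in> obj C"
  shows "card (homs C X T) \<le> card (homs C A T) * card (homs C B T)"
proof -
  note h = ses_homs[OF ip]
  have obj: "A \<in> obj C" "B \<in> obj C" "X \<in> obj C"
    using h homs_obj by blast+
  \<comment> \<open>A choice of extension for each map that extends along \<open>i\<close>. Its
    arbitrary values at other maps do no harm, since the parametrisation below has only to be
    surjective.\<close>
  define s where "s = inv_into (homs C X T) (\<lambda>f. f \<star> i)"
  have finI: "finite (homs C A T \<times> homs C B T)"
    using fin T obj by (simp add: hom_finite_def)
  have "homs C X T \<subseteq> (\<lambda>(a, b). s b \<boxplus> (a \<star> p)) ` (homs C A T \<times> homs C B T)"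
  proof
    fix f assume f: "f \<in> homs C X T"
    then have sf: "s (f \<star> i) \<in> homs C X T" "s (f \<star> i) \<star> i = f \<star> i"
      unfolding s_def by (simp_all add: inv_into_into f_inv_into_f[of _ "\<lambda>f. f \<star> i"])
    obtain d where d: "d \<in> homs C X T" "f = s (f \<star> i) \<boxplus> d"
      using msub_ex[OF f sf(1)] by blast
    have fi: "f \<star> i \<in> homs C B T" using h(1) f by (rule cmp_hom)
    have "(f \<star> i) \<boxplus> (d \<star> i) = f \<star> i"
      using cmp_madd_left[OF h(1) sf(1) d(1)] d(2) sf(2) by simp
    then have "d \<star> i = zmor C B T"
      using madd_eq_self[OF fi _ cmp_hom[OF h(1) d(1)]] by blast
    then obtain a where "a \<in> homs C A T" "a \<star> p = d"
      using ses_cokernel[OF ip d(1)] by blast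
    then show "f \<in> (\<lambda>(a, b). s b \<boxplus> (a \<star> p)) ` (homs C A T \<times> homs C B T)"
      using d fi by (intro image_eqI[of _ _ "(a, f \<star> i)"]) auto
  qed
  then have "card (homs C X T) \<le> card (homs C A T \<times> homs C B T)"
    using finI by (rule surj_card_le[rotated])
  then show ?thesis by (simp add: card_cartesian_product)
qed

text \<open>If the sequence does not split, the identity of \<open>A\<close> does not lift along
  \<open>p\<close>, which makes |Hom(A,X)| strictly smaller than |Hom(A,S)|. Together with
  |Hom(B,X)| \<le> |Hom(B,S)| and the bounds for maps out of \<open>X\<close> and \<open>S\<close>
  this gives the claim.\<close>

lemma card_End_less_direct_sum:
  assumes fin: "hom_finite C" and "ses C A B X \<noteq> {}"
    and S: "is_direct_sum C A B S" and X: "\<not> is_direct_sum C A B X"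
  shows "card (homs C X X) < card (homs C S S)"
proof -
  obtain i p where ip: "(i, p) \<in> ses C A B X"
    using assms(2) by auto
  note h = ses_homs[OF ip]
  have obj: "A \<in> obj C" "B \<in> obj C" "X \<in> obj C" "S \<in> obj C"
    using h homs_obj S by (auto simp: is_direct_sum_def)
  \<comment> \<open>Every Hom set contains a zero map; positivity of the factors keeps inequalities
    strict under multiplication.\<close>
  have pos: "card (homs C U V) > 0" if "U \<in> obj C" "V \<in> obj C" for U V
    using fin zmor_hom[OF that] that by (auto simp: card_gt_0_iff hom_finite_def)
  have "(\<lambda>f. p \<star> f) ` homs C A X \<subset> homs C A A"
  proof
    show "(\<lambda>f. p \<star> f) ` homs C A X \<subseteq> homs C A A"
      using cmp_hom[OF _ h(2)] by blast
    show "(\<lambda>f. p \<star> f) ` homs C A X \<noteq> homs C A A"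
    proof
      assume "(\<lambda>f. p \<star> f) ` homs C A X = homs C A A"
      then obtain s where "s \<in> homs C A X" "p \<star> s = idt C A"
        using idt_hom[OF obj(1)] by (metis imageE)
      then show False
        using direct_sum_if_section[OF ip] X by blast
    qed
  qed
  then have "card ((\<lambda>f. p \<star> f) ` homs C A X) < card (homs C A A)"
    using fin obj by (intro psubset_card_mono) (simp_all add: hom_finite_def)
  then have "card (homs C A X) < card (homs C A A) * card (homs C A B)"
    using card_homs_to_ses[OF fin ip obj(1)] pos[OF obj(1,2)]
    by (meson le_less_trans mult_less_mono1)
  then have AX: "card (homs C A X) < card (homs C A S)"
    using card_homs_direct_sum(1)[OF fin S obj(1)] by linarith
  have "card ((\<lambda>f. p \<star> f) ` homs C B X) \<le> card (homs C B A)"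
    using fin obj cmp_hom[OF _ h(2)] by (intro card_mono) (auto simp: hom_finite_def)
  then have "card (homs C B X) \<le> card (homs C B A) * card (homs C B B)"
    using card_homs_to_ses[OF fin ip obj(2)] by (meson le_trans mult_le_mono1)
  then have BX: "card (homs C B X) \<le> card (homs C B S)"
    using card_homs_direct_sum(1)[OF fin S obj(2)] by linarith
  have "card (homs C X X) \<le> card (homs C A X) * card (homs C B X)"
    using card_homs_from_ses[OF fin ip obj(3)] .
  also have "\<dots> \<le> card (homs C A X) * card (homs C B S)"
    using BX by (rule mult_le_mono2)
  also have "\<dots> < card (homs C A S) * card (homs C B S)"
    using AX pos[OF obj(2,4)] by (rule mult_less_mono1)
  also have "\<dots> \<le> card (homs C S S)"
    using card_homs_direct_sum(2)[OF fin S obj(4)] .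
  finally show ?thesis .
qed

text \<open>A cokernel of a map from zero is an isomorphism, and conversely each isomorphism arises
  by transporting the split sequence. The exact set is determined, not just its existence, since its
  cardinality enters the structure constants involving [0].\<close>

lemma ses_zero_sub:
  assumes Z: "is_zero_object C Z" and X: "X \<in> obj C" and A: "A \<in> obj C"
  shows "ses C A Z X = {zmor C Z X} \<times> isos C X A"
proof -
  have Zo: "Z \<in> obj C" using Z by (simp add: is_zero_object_def)
  have "(i, p) \<in> ses C A Z X \<longleftrightarrow> (i, p) \<in> {zmor C Z X} \<times> isos C X A" for i p
  proof
    assume ip: "(i, p) \<in> ses C A Z X"
    note h = ses_homs[OF ip]
    have i: "i = zmor C Z X" using h(1) homs_zero_object[OF Z X] by simp
    \<comment> \<open>The identity of \<open>X\<close> vanishes on the zero object, so it factors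
      through the cokernel \<open>p\<close>; the factor \<open>g\<close> is the inverse of
      \<open>p\<close>.\<close>
    have "idt C X \<star> i = zmor C Z X" using i h(1) cmp_idt_left by simp
    then obtain g where g: "g \<in> homs C A X" "g \<star> p = idt C X"
      using ses_cokernel[OF ip idt_hom[OF X]] by blast
    have "(p \<star> g) \<star> p = idt C A \<star> p"
      using cmp_assoc[OF h(2) g(1) h(2)] g(2) cmp_idt_right[OF h(2)] cmp_idt_left[OF h(2)] by simp
    then have "p \<star> g = idt C A"
      using ses_epi[OF ip cmp_hom[OF g(1) h(2)] idt_hom[OF A]] by simp
    then show "(i, p) \<in> {zmor C Z X} \<times> isos C X A"
      using i g h unfolding isos_def by blast
  next
    assume "(i, p) \<in> {zmor C Z X} \<times> isos C X A"
    then have i: "i = zmor C Z X" and p: "p \<in> isos C X A" by auto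
    have "(zmor C Z X, idt C X) \<in> confl C"
      using confl_split[OF Zo X X is_biproduct_zero[OF Z X]] .
    then have "(zmor C Z X, p) \<in> confl C"
      using confl_iso_closed[OF _ zmor_hom[OF Zo X] idt_hom[OF X] zmor_hom[OF Zo X] isos_hom[OF p]
          idt_isos[OF Zo] idt_isos[OF X] p]
        zmor_hom[OF Zo X] by (simp add: cmp_idt_left cmp_idt_right)
    then show "(i, p) \<in> ses C A Z X"
      using i p zmor_hom[OF Zo X] isos_hom by (auto simp: ses_def)
  qed
  then show ?thesis by auto
qed

text \<open>Dual to the preceding case: a kernel of a map to zero is an isomorphism.\<close>

lemma ses_zero_quot:
  assumes Z: "is_zero_object C Z" and X: "X \<in> obj C" and B: "B \<in> obj C"
  shows "ses C Z B X = isos C B X \<times> {zmor C X Z}"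
proof -
  have Zo: "Z \<in> obj C" using Z by (simp add: is_zero_object_def)
  have "(i, p) \<in> ses C Z B X \<longleftrightarrow> (i, p) \<in> isos C B X \<times> {zmor C X Z}" for i p
  proof
    assume ip: "(i, p) \<in> ses C Z B X"
    note h = ses_homs[OF ip]
    have p: "p = zmor C X Z" using h(2) homs_zero_object[OF Z X] by simp
    have "p \<star> idt C X = zmor C X Z" using p h(2) cmp_idt_right by simp
    then obtain g where g: "g \<in> homs C X B" "i \<star> g = idt C X"
      using ses_kernel[OF ip idt_hom[OF X]] by blast
    have "i \<star> (g \<star> i) = i \<star> idt C B"
      using cmp_assoc[OF h(1) g(1) h(1)] g(2) cmp_idt_left[OF h(1)] cmp_idt_right[OF h(1)] by simp
    then have "g \<star> i = idt C B"
      using ses_mono[OF ip cmp_hom[OF h(1) g(1)] idt_hom[OF B]] by simp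
    then show "(i, p) \<in> isos C B X \<times> {zmor C X Z}"
      using p g h unfolding isos_def by blast
  next
    assume "(i, p) \<in> isos C B X \<times> {zmor C X Z}"
    then have p: "p = zmor C X Z" and i: "i \<in> isos C B X" by auto
    have "(idt C B, zmor C B Z) \<in> confl C"
      using confl_split[OF B Zo B is_biproduct_commute[OF is_biproduct_zero[OF Z B]]] .
    then have "(i, zmor C X Z) \<in> confl C"
      using confl_iso_closed[OF _ idt_hom[OF B] zmor_hom[OF B Zo] isos_hom[OF i] zmor_hom[OF X Zo]
          idt_isos[OF B] i idt_isos[OF Zo]]
        zmor_hom[OF B Zo] by (simp add: cmp_idt_left cmp_zmor_left[OF isos_hom[OF i] Zo])
    then show "(i, p) \<in> ses C Z B X"
      using p i zmor_hom[OF X Zo] isos_hom by (auto simp: ses_def)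
  qed
  then show ?thesis by auto
qed

end

section \<open>Primitive elements and products in the Hall algebra\<close>

definition degree_classes :: "('o, 'm, 'x) exact_cat_scheme \<Rightarrow> 'o set set \<Rightarrow> 'o set set" where
  "degree_classes C \<gamma> = {c \<in> Iso C. class_degree C c = \<gamma>}"

lemma degree_classes_eq: "{iso_class C X | X. X \<in> obj C \<and> degree C X = \<gamma>} = degree_classes C \<gamma>"
  by (auto simp: degree_classes_def Iso_def degree_def)

lemma hall_graded_eq: "hall_graded C \<gamma> = qvs.span (bvec ` degree_classes C \<gamma>)"
proof -
  have "{bvec (iso_class C M) | M. M \<in> obj C \<and> degree C M = \<gamma>}
      = bvec ` {iso_class C X | X. X \<in> obj C \<and> degree C X = \<gamma>}"
    by blast
  then show ?thesis
    by (simp add: hall_graded_def degree_classes_eq)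
qed

lemma class_degree_carrier: "c \<in> Iso C \<Longrightarrow> class_degree C c \<in> carrier (Groth C)"
  by (simp add: Groth_def class_degree_def quotientI)

text \<open>The generating relation is symmetric, so \<open>x\<close> and \<open>y\<close> are
  related in both directions; by transitivity they then have the same image under the
  congruence.\<close>

lemma class_degree_eq_if_Ext1:
  assumes "M \<in> obj C" "N \<in> obj C" "x \<in> Ext1 C M N" "y \<in> Ext1 C M N"
  shows "class_degree C x = class_degree C y"
proof -
  have xy: "(x, y) \<in> groth_cong C" "(y, x) \<in> groth_cong C"
    unfolding groth_cong_def using assms by (intro r_into_trancl; blast)+
  have "trans (groth_cong C)"
    by (simp add: groth_cong_def)
  then show ?thesis
    using xy by (auto simp: class_degree_def dest: transD)
qed

text \<open>The weights of Green's form on the Hall algebra.\<close>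

definition aut_weight :: "('o, 'm, 'x) cat_scheme \<Rightarrow> 'o set \<Rightarrow> rat" where
  "aut_weight C c = 1 / of_nat (card (auts C (rep c)))"

lemma lookup_bvec: "Poly_Mapping.lookup (bvec a) b = (if b = a then 1 else 0)"
  by (simp add: bvec_def lookup_single when_def)

lemma lookup_tensor:
  "Poly_Mapping.lookup (tensor v w) (a, b) = Poly_Mapping.lookup v a * Poly_Mapping.lookup w b"
proof -
  let ?v = "Poly_Mapping.lookup v" and ?w = "Poly_Mapping.lookup w"
  have *: "(\<Sum>b' \<in> Poly_Mapping.keys w. ?v a' * ?w b' * (if a = a' \<and> b = b' then 1 else 0))
      = (if a' = a then ?v a * ?w b else 0)" for a'
  proof (cases "a' = a")
    case True
    have "(\<Sum>b' \<in> Poly_Mapping.keys w. ?v a * ?w b' * (if a = a' \<and> b = b' then 1 else 0))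
        = (\<Sum>b' \<in> Poly_Mapping.keys w. if b' = b then ?v a * ?w b else 0)"
      using True by (intro sum.cong) auto
    then show ?thesis
      using True by (simp add: in_keys_iff)
  next
    case False
    then show ?thesis by (simp add: sum.neutral)
  qed
  have "Poly_Mapping.lookup (tensor v w) (a, b)
      = (\<Sum>a' \<in> Poly_Mapping.keys v. \<Sum>b' \<in> Poly_Mapping.keys w.
          ?v a' * ?w b' * (if a = a' \<and> b = b' then 1 else 0))"
    by (simp add: tensor_def lookup_sum lookup_bvec)
  also have "\<dots> = ?v a * ?w b"
    unfolding * by (simp add: in_keys_iff)
  finally show ?thesis .
qed

lemma sum_lookup_delta:
  fixes v :: "'b \<Rightarrow>\<^sub>0 rat"
  shows "(\<Sum>c \<in> Poly_Mapping.keys v. Poly_Mapping.lookup v c * (if b = c then 1 else 0))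
    = Poly_Mapping.lookup v b"
proof -
  have "(\<Sum>c \<in> Poly_Mapping.keys v. Poly_Mapping.lookup v c * (if b = c then 1 else 0))
      = (\<Sum>c \<in> Poly_Mapping.keys v. if b = c then Poly_Mapping.lookup v b else 0)"
    by (intro sum.cong) auto
  then show ?thesis by (simp add: in_keys_iff)
qed

lemma hall_mult_bvec: "hall_mult C (bvec a) (bvec b) = hall_mult_basis C a b"
  by (simp add: hall_mult_def bvec_def)

section \<open>Finiteness and structure constants of the product\<close>

locale finitary_exact_category = exact_category C for C (structure) +
  assumes profinitary: "profinitary C" and cofinitary: "cofinitary C"
begin

lemma hom_finite: "hom_finite C"
  using profinitary by (simp add: profinitary_def)

lemma finite_degree_classes: "\<gamma> \<in> carrier (Groth C) \<Longrightarrow> finite (degree_classes C \<gamma>)"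
  using profinitary by (simp add: profinitary_def degree_classes_eq)

lemma card_auts_pos:
  assumes "A \<in> obj C"
  shows "card (auts C A) > 0"
proof -
  have "finite (auts C A)"
    using hom_finite assms by (intro finite_subset[of "auts C A" "homs C A A"])
      (auto simp: hom_finite_def isos_def)
  then show ?thesis
    using idt_isos[OF assms] by (auto simp: card_gt_0_iff)
qed

lemma aut_weight_pos: "c \<in> Iso C \<Longrightarrow> aut_weight C c > 0"
  using card_auts_pos Iso_rep by (simp add: aut_weight_def)

lemma finite_ses:
  assumes "A \<in> obj C" "B \<in> obj C" "X \<in> obj C"
  shows "finite (ses C A B X)"
proof (rule finite_subset)
  show "ses C A B X \<subseteq> homs C B X \<times> homs C X A"
    by (auto simp: ses_def)
  show "finite (homs C B X \<times> homs C X A)"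
    using hom_finite assms by (simp add: hom_finite_def)
qed

text \<open>Hom-finiteness matters here: \<open>card\<close> of an infinite set of sequences would
  be 0, and so would a quotient by an infinite automorphism group.\<close>

lemma class_hall_num_eq_0_iff:
  assumes "a \<in> Iso C" "b \<in> Iso C" "c \<in> Iso C"
  shows "class_hall_num C a b c = 0 \<longleftrightarrow> ses C (rep a) (rep b) (rep c) = {}"
  using card_auts_pos[of "rep a"] card_auts_pos[of "rep b"] finite_ses[of "rep a" "rep b" "rep c"]
    assms Iso_rep by (simp add: class_hall_num_def hall_num_def)

lemma class_hall_num_Ext1:
  assumes "a \<in> Iso C" "b \<in> Iso C" "c \<in> Iso C" "class_hall_num C a b c \<noteq> 0"
  shows "c \<in> Ext1 C (rep a) (rep b)"
  using assms class_hall_num_eq_0_iff[of a b c] Iso_rep[OF assms(3)] by (auto simp: Ext1_def)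

text \<open>All classes that occur in [A][B] lie in one Ext set, and so have one degree. This gives
  both finiteness of the product, by profinitarity, and its homogeneity.\<close>

lemma hall_mult_basis_support:
  assumes "a \<in> Iso C" "b \<in> Iso C"
  obtains \<gamma> where "\<gamma> \<in> carrier (Groth C)" "{c \<in> Iso C. class_hall_num C a b c \<noteq> 0} \<subseteq> degree_classes C \<gamma>"
proof (cases "{c \<in> Iso C. class_hall_num C a b c \<noteq> 0} = {}")
  \<comment> \<open>With empty support any degree will do; the degree of \<open>a\<close> is
    taken.\<close>
  case True
  then show ?thesis
    using that[OF class_degree_carrier[OF assms(1)]] by blast
next
  case False
  then obtain c where c: "c \<in> Iso C" "class_hall_num C a b c \<noteq> 0" by blast
  have "class_degree C d = class_degree C c" if "d \<in> Iso C" "class_hall_num C a b d \<noteq> 0" for d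
    using class_hall_num_Ext1[OF assms] that c Iso_rep(1)[OF assms(1)] Iso_rep(1)[OF assms(2)]
    by (intro class_degree_eq_if_Ext1[of "rep a" _ "rep b"]) auto
  then show ?thesis
    using that[OF class_degree_carrier[OF c(1)]] by (auto simp: degree_classes_def)
qed

lemma finite_hall_mult_basis_support:
  assumes "a \<in> Iso C" "b \<in> Iso C"
  shows "finite {c \<in> Iso C. class_hall_num C a b c \<noteq> 0}"
proof -
  obtain \<gamma> where "\<gamma> \<in> carrier (Groth C)"
    and *: "{c \<in> Iso C. class_hall_num C a b c \<noteq> 0} \<subseteq> degree_classes C \<gamma>"
    using hall_mult_basis_support[OF assms] by blast
  then have "finite (degree_classes C \<gamma>)"
    by (intro finite_degree_classes)
  with * show ?thesis
    by (rule finite_subset)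
qed

lemma lookup_hall_mult_basis:
  assumes "a \<in> Iso C" "b \<in> Iso C"
  shows "Poly_Mapping.lookup (hall_mult_basis C a b) c = (if c \<in> Iso C then class_hall_num C a b c else 0)"
proof -
  let ?K = "{c \<in> Iso C. class_hall_num C a b c \<noteq> 0}"
  have "Poly_Mapping.lookup (hall_mult_basis C a b) c
      = (\<Sum>d \<in> ?K. if d = c then class_hall_num C a b c else 0)"
    unfolding hall_mult_basis_def lookup_sum
    by (intro sum.cong) (auto simp: lookup_bvec)
  then show ?thesis
    using finite_hall_mult_basis_support[OF assms] by simp
qed

lemma hall_mult_basis_graded:
  assumes "a \<in> Iso C" "b \<in> Iso C"
  obtains \<gamma> where "hall_mult_basis C a b \<in> hall_graded C \<gamma>"
proof -
  obtain \<gamma> where "{c \<in> Iso C. class_hall_num C a b c \<noteq> 0} \<subseteq> degree_classes C \<gamma>"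
    using hall_mult_basis_support[OF assms] by blast
  then have "Poly_Mapping.keys (hall_mult_basis C a b) \<subseteq> degree_classes C \<gamma>"
    by (auto simp: in_keys_iff lookup_hall_mult_basis[OF assms] split: if_splits)
  then show ?thesis
    using that by (simp add: hall_graded_eq span_bvec)
qed

section \<open>The zero class, the coproduct and primitive elements\<close>

lemma zero_iso_class_Iso: "zero_iso_class C \<in> Iso C"
  and is_zero_object_rep: "is_zero_object C (rep (zero_iso_class C))"
proof -
  obtain Z where Z: "is_zero_object C Z"
    using zero_object_ex by blast
  then have obj: "Z \<in> obj C" by (simp add: is_zero_object_def)
  then show "zero_iso_class C \<in> Iso C"
    using zero_iso_class_eq[OF Z] iso_class_Iso by simp
  have "rep (zero_iso_class C) \<in> zero_iso_class C"
    using rep_iso_class[OF obj] zero_iso_class_eq[OF Z] by simp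
  then show "is_zero_object C (rep (zero_iso_class C))"
    by (simp add: zero_iso_class_def)
qed

lemma card_isos_rep:
  assumes "b \<in> Iso C" "c \<in> Iso C"
  shows "card (isos C (rep b) (rep c)) = (if b = c then card (auts C (rep c)) else 0)"
proof (cases "b = c")
  case False
  then have "isos C (rep b) (rep c) = {}"
    using Iso_rep(2)[OF assms(1)] Iso_rep(2)[OF assms(2)] iso_class_eqI[of _ "rep b" "rep c"] by blast
  then show ?thesis using False by simp
qed simp

text \<open>Sequences with a zero end correspond to isomorphisms, whose number cancels against the
  automorphism factors. These coefficients produce the two terms of the coproduct that involve the
  unit.\<close>

lemma class_hall_conum_zero:
  assumes "b \<in> Iso C" "c \<in> Iso C"
  shows "class_hall_conum C (zero_iso_class C) b c = (if b = c then 1 else 0)"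
    and "class_hall_conum C b (zero_iso_class C) c = (if b = c then 1 else 0)"
proof -
  note obj = Iso_rep(1)[OF assms(1)] Iso_rep(1)[OF assms(2)]
  let ?z = "rep (zero_iso_class C)"
  have pos: "card (auts C (rep b)) > 0" "card (auts C (rep c)) > 0" "card (auts C ?z) > 0"
    using obj is_zero_object_rep card_auts_pos by (simp_all add: is_zero_object_def)
  have "card (ses C (rep b) ?z (rep c)) = (if b = c then card (auts C (rep c)) else 0)"
    using card_isos_rep[OF assms(2,1)]
    by (auto simp: ses_zero_sub[OF is_zero_object_rep obj(2,1)] card_cartesian_product)
  then show "class_hall_conum C (zero_iso_class C) b c = (if b = c then 1 else 0)"
    using pos by (simp add: class_hall_conum_def class_hall_num_def hall_num_def)
  have "card (ses C ?z (rep b) (rep c)) = (if b = c then card (auts C (rep c)) else 0)"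
    using card_isos_rep[OF assms]
    by (auto simp: ses_zero_quot[OF is_zero_object_rep obj(2,1)] card_cartesian_product)
  then show "class_hall_conum C b (zero_iso_class C) c = (if b = c then 1 else 0)"
    using pos by (simp add: class_hall_conum_def class_hall_num_def hall_num_def)
qed

lemma lookup_hall_comult_basis:
  assumes c: "c \<in> Iso C"
  shows "Poly_Mapping.lookup (hall_comult_basis C c) (a, b)
    = (if a \<in> Iso C \<and> b \<in> Iso C then class_hall_conum C a b c else 0)"
proof -
  let ?K = "{(a, b). a \<in> Iso C \<and> b \<in> Iso C \<and> class_hall_conum C a b c \<noteq> 0}"
  let ?L = "{(iso_class C A, iso_class C B) | A B.
        A \<in> obj C \<and> B \<in> obj C \<and> iso_class C (rep c) \<in> Ext1 C A B}"
  have "finite ?L"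
    using cofinitary Iso_rep(1)[OF c] unfolding cofinitary_def by blast
  \<comment> \<open>The swap reflects that the coefficient at \<open>(a, b)\<close> counts sequences
    with subobject \<open>a\<close> and quotient \<open>b\<close>. Cofinitarity bounds the pairs in
    the opposite order.\<close>
  moreover have "?K \<subseteq> prod.swap ` ?L"
  proof clarify
    fix a b assume ab: "a \<in> Iso C" "b \<in> Iso C" "class_hall_conum C a b c \<noteq> 0"
    then have "class_hall_num C b a c \<noteq> 0"
      by (auto simp: class_hall_conum_def)
    then have "c \<in> Ext1 C (rep b) (rep a)"
      using class_hall_num_Ext1[OF ab(2,1) c] by blast
    then have "(iso_class C (rep b), iso_class C (rep a)) \<in> ?L"
      using Iso_rep(1)[OF ab(1)] Iso_rep(1)[OF ab(2)] Iso_rep(2)[OF c] by force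
    then show "(a, b) \<in> prod.swap ` ?L"
      unfolding Iso_rep(2)[OF ab(1)] Iso_rep(2)[OF ab(2)] by (rule rev_image_eqI) simp
  qed
  ultimately have fin: "finite ?K"
    by (rule finite_subset[rotated, OF finite_imageI])
  have "Poly_Mapping.lookup (hall_comult_basis C c) (a, b)
      = (\<Sum>x \<in> ?K. if x = (a, b) then class_hall_conum C a b c else 0)"
    unfolding hall_comult_basis_def lookup_sum
    by (intro sum.cong) (auto simp: lookup_tensor lookup_bvec split: if_splits)
  then show ?thesis
    using fin by simp
qed

lemma lookup_hall_comult:
  assumes "Poly_Mapping.keys v \<subseteq> Iso C"
  shows "Poly_Mapping.lookup (hall_comult C v) (a, b) = (if a \<in> Iso C \<and> b \<in> Iso C
    then \<Sum>c \<in> Poly_Mapping.keys v. Poly_Mapping.lookup v c * class_hall_conum C a b c else 0)"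
proof -
  have "Poly_Mapping.lookup (hall_comult C v) (a, b)
      = (\<Sum>c \<in> Poly_Mapping.keys v.
          Poly_Mapping.lookup v c * Poly_Mapping.lookup (hall_comult_basis C c) (a, b))"
    by (simp add: hall_comult_def lookup_sum)
  also have "\<dots> = (\<Sum>c \<in> Poly_Mapping.keys v. Poly_Mapping.lookup v c *
      (if a \<in> Iso C \<and> b \<in> Iso C then class_hall_conum C a b c else 0))"
    using assms by (intro sum.cong refl) (auto simp: lookup_hall_comult_basis)
  finally show ?thesis by (auto intro: sum.neutral)
qed

text \<open>Adjointness of coproduct and opposite product. The automorphism factors of
  \<open>a\<close> and \<open>b\<close> are the inverse weights of the induced form on the tensor
  square.\<close>

lemma hall_comult_wform:
  assumes "Poly_Mapping.keys v \<subseteq> Iso C" "a \<in> Iso C" "b \<in> Iso C"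
  shows "Poly_Mapping.lookup (hall_comult C v) (a, b)
    = of_nat (card (auts C (rep a))) * of_nat (card (auts C (rep b)))
      * wform (aut_weight C) v (hall_mult_basis C b a)"
proof -
  let ?n = "\<lambda>a. of_nat (card (auts C (rep a))) :: rat"
  have "Poly_Mapping.lookup (hall_comult C v) (a, b)
      = (\<Sum>c \<in> Poly_Mapping.keys v. Poly_Mapping.lookup v c * (?n a * ?n b / ?n c * class_hall_num C b a c))"
    using assms by (simp add: lookup_hall_comult class_hall_conum_def)
  also have "\<dots> = (\<Sum>c \<in> Poly_Mapping.keys v. ?n a * ?n b * (aut_weight C c
      * Poly_Mapping.lookup v c * Poly_Mapping.lookup (hall_mult_basis C b a) c))"
    using assms by (intro sum.cong refl) (auto simp: lookup_hall_mult_basis aut_weight_def)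
  finally show ?thesis
    by (simp add: wform_def sum_distrib_left)
qed

text \<open>The primitivity equation is compared coordinate by coordinate. If \<open>a\<close> or
  \<open>b\<close> is [0], both sides agree by \<open>class_hall_conum_zero\<close>; otherwise the
  right-hand side is zero, and adjointness turns the equation into orthogonality to a
  product.\<close>

lemma Prim_iff_orthogonal_products:
  assumes v: "Poly_Mapping.keys v \<subseteq> Iso C - {zero_iso_class C}"
  shows "v \<in> Prim C \<longleftrightarrow> (\<forall>a \<in> Iso C - {zero_iso_class C}. \<forall>b \<in> Iso C - {zero_iso_class C}.
    wform (aut_weight C) v (hall_mult_basis C a b) = 0)"
    (is "_ \<longleftrightarrow> ?R")
proof -
  let ?z = "zero_iso_class C"
  let ?v = "Poly_Mapping.lookup v"
  let ?rhs = "\<lambda>a b. ?v a * (if b = ?z then 1 else 0) + (if a = ?z then 1 else 0) * ?v b"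
  have vI: "Poly_Mapping.keys v \<subseteq> Iso C" using v by blast
  have vz: "?v ?z = 0" using v by (auto simp: in_keys_iff)
  have vn: "?v a = 0" if "a \<notin> Iso C" for a using v that by (auto simp: in_keys_iff)
  have "v \<in> hall_space C"
    using vI by (simp add: hall_space_def span_bvec)
  then have "v \<in> Prim C \<longleftrightarrow> hall_comult C v = tensor v (hall_one C) + tensor (hall_one C) v"
    by (simp add: Prim_def)
  also have "\<dots> \<longleftrightarrow> (\<forall>a b. Poly_Mapping.lookup (hall_comult C v) (a, b) = ?rhs a b)"
    by (simp add: poly_mapping_eq_iff fun_eq_iff lookup_add lookup_tensor hall_one_def lookup_bvec)
  also have "\<dots> \<longleftrightarrow> ?R"
  proof
    assume L: "\<forall>a b. Poly_Mapping.lookup (hall_comult C v) (a, b) = ?rhs a b"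
    show ?R
    proof (intro ballI)
      fix a b assume ab: "a \<in> Iso C - {?z}" "b \<in> Iso C - {?z}"
      then have "Poly_Mapping.lookup (hall_comult C v) (b, a) = 0"
        using L by simp
      moreover have "card (auts C (rep a)) > 0" "card (auts C (rep b)) > 0"
        using ab card_auts_pos Iso_rep(1) by auto
      ultimately show "wform (aut_weight C) v (hall_mult_basis C a b) = 0"
        using hall_comult_wform[OF vI, of b a] ab by simp
    qed
  next
    assume R: ?R
    show "\<forall>a b. Poly_Mapping.lookup (hall_comult C v) (a, b) = ?rhs a b"
    proof (intro allI)
      fix a b
      \<comment> \<open>The second and third cases overlap at ([0], [0]), where both sides vanish
        because \<open>v\<close> has no coordinate at [0].\<close>
      consider "a \<notin> Iso C \<or> b \<notin> Iso C" | "a \<in> Iso C" "b \<in> Iso C" "a = ?z"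
        | "a \<in> Iso C" "b \<in> Iso C" "b = ?z" | "a \<in> Iso C - {?z}" "b \<in> Iso C - {?z}"
        by blast
      then show "Poly_Mapping.lookup (hall_comult C v) (a, b) = ?rhs a b"
      proof cases
        case 1
        then show ?thesis
          using vn zero_iso_class_Iso vz by (auto simp: lookup_hall_comult[OF vI])
      next
        case 2
        then have "Poly_Mapping.lookup (hall_comult C v) (a, b)
            = (\<Sum>c \<in> Poly_Mapping.keys v. ?v c * class_hall_conum C a b c)"
          by (simp add: lookup_hall_comult[OF vI])
        also have "\<dots> = (\<Sum>c \<in> Poly_Mapping.keys v. ?v c * (if b = c then 1 else 0))"
          using class_hall_conum_zero(1)[OF 2(2)] 2(3) subsetD[OF vI] by (intro sum.cong refl) simp
        finally show ?thesis
          using 2 vz by (simp add: sum_lookup_delta)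
      next
        case 3
        then have "Poly_Mapping.lookup (hall_comult C v) (a, b)
            = (\<Sum>c \<in> Poly_Mapping.keys v. ?v c * class_hall_conum C a b c)"
          by (simp add: lookup_hall_comult[OF vI])
        also have "\<dots> = (\<Sum>c \<in> Poly_Mapping.keys v. ?v c * (if a = c then 1 else 0))"
          using class_hall_conum_zero(2)[OF 3(1)] 3(3) subsetD[OF vI] by (intro sum.cong refl) simp
        finally show ?thesis
          using 3 vz by (simp add: sum_lookup_delta)
      next
        case 4
        then show ?thesis
          using R hall_comult_wform[OF vI, of a b] by simp
      qed
    qed
  qed
  finally show ?thesis .
qed

section \<open>The space of products and its orthogonal complement\<close>

lemma ker_counit_eq: "ker_counit C = {v. Poly_Mapping.keys v \<subseteq> Iso C - {zero_iso_class C}}"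
proof -
  let ?z = "zero_iso_class C"
  have "hall_counit C v = Poly_Mapping.lookup v ?z" for v
    using sum_lookup_delta[of v ?z] by (simp add: hall_counit_def eq_commute)
  then show ?thesis
    by (auto simp: ker_counit_def hall_space_def span_bvec in_keys_iff)
qed

text \<open>By bilinearity it is enough to multiply basis vectors, and the kernel of the counit has
  the nonzero classes as a basis.\<close>

lemma hall_P_eq:
  "hall_P C = qvs.span ((\<lambda>(a, b). hall_mult_basis C a b) `
    ((Iso C - {zero_iso_class C}) \<times> (Iso C - {zero_iso_class C})))"
    (is "_ = qvs.span ?M")
proof -
  have "{hall_mult C v w | v w. v \<in> ker_counit C \<and> w \<in> ker_counit C} \<subseteq> qvs.span ?M"
  proof clarify
    fix v w assume "v \<in> ker_counit C" "w \<in> ker_counit C"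
    then show "hall_mult C v w \<in> qvs.span ?M"
      unfolding hall_mult_def
      by (intro qvs.span_sum qvs.span_scale qvs.span_base) (auto simp: ker_counit_eq)
  qed
  moreover have "hall_mult_basis C a b \<in>
      qvs.span {hall_mult C v w | v w. v \<in> ker_counit C \<and> w \<in> ker_counit C}"
    if "a \<in> Iso C - {zero_iso_class C}" "b \<in> Iso C - {zero_iso_class C}" for a b
  proof -
    have "bvec a \<in> ker_counit C" "bvec b \<in> ker_counit C"
      using that by (simp_all add: ker_counit_eq bvec_def)
    then show ?thesis
      by (metis (mono_tags, lifting) hall_mult_bvec mem_Collect_eq qvs.span_base)
  qed
  then have "?M \<subseteq> qvs.span {hall_mult C v w | v w. v \<in> ker_counit C \<and> w \<in> ker_counit C}"
    by auto
  ultimately show ?thesis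
    unfolding hall_P_def qvs.span_eq by blast
qed

text \<open>The degree of [0] is the unit of the monoid; this is how \<gamma> \<noteq> 0 enters the
  argument.\<close>

lemma degree_classes_nonzero:
  assumes "\<gamma> \<noteq> \<one>\<^bsub>Groth C\<^esub>"
  shows "degree_classes C \<gamma> \<subseteq> Iso C - {zero_iso_class C}"
  using assms by (auto simp: degree_classes_def Groth_def)

lemma wform_disjoint_degrees:
  assumes "v \<in> hall_graded C \<gamma>" "w \<in> hall_graded C \<delta>" "\<gamma> \<noteq> \<delta>"
  shows "wform \<omega> v w = 0"
proof -
  have "Poly_Mapping.lookup w c = 0" if "c \<in> Poly_Mapping.keys v" for c
  proof -
    have "class_degree C c = \<gamma>"
      using assms(1) that by (auto simp: hall_graded_eq span_bvec degree_classes_def)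
    then have "c \<notin> Poly_Mapping.keys w"
      using assms(2,3) by (auto simp: hall_graded_eq span_bvec degree_classes_def)
    then show ?thesis by (simp add: in_keys_iff)
  qed
  then show ?thesis by (simp add: wform_def)
qed

text \<open>Orthogonality to all products reduces to orthogonality to the degree \<gamma> part of
  \<open>hall_P C\<close>: each product of basis elements is homogeneous, and those of another
  degree are orthogonal to \<open>v\<close> because the supports are disjoint.\<close>

lemma Prim_graded_eq_orthogonal_complement:
  assumes \<gamma>: "\<gamma> \<noteq> \<one>\<^bsub>Groth C\<^esub>"
  shows "Prim_graded C \<gamma> =
    {v \<in> qvs.span (bvec ` degree_classes C \<gamma>). \<forall>u \<in> hall_P_graded C \<gamma>. wform (aut_weight C) u v = 0}"
proof -
  let ?I = "Iso C - {zero_iso_class C}"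
  have "v \<in> Prim C \<longleftrightarrow> (\<forall>u \<in> hall_P_graded C \<gamma>. wform (aut_weight C) u v = 0)"
    if v: "v \<in> hall_graded C \<gamma>" for v
  proof -
    have "Poly_Mapping.keys v \<subseteq> ?I"
      using v degree_classes_nonzero[OF \<gamma>] by (auto simp: hall_graded_eq span_bvec)
    then have iff: "v \<in> Prim C \<longleftrightarrow>
        (\<forall>a \<in> ?I. \<forall>b \<in> ?I. wform (aut_weight C) v (hall_mult_basis C a b) = 0)"
      by (rule Prim_iff_orthogonal_products)
    show ?thesis
    proof
      assume "v \<in> Prim C"
      then have "(\<lambda>(a, b). hall_mult_basis C a b) ` (?I \<times> ?I) \<subseteq> {w. wform (aut_weight C) v w = 0}"
        using iff by auto
      then have "hall_P C \<subseteq> {w. wform (aut_weight C) v w = 0}"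
        unfolding hall_P_eq by (rule qvs.span_minimal[OF _ subspace_wform_kernel])
      then show "\<forall>u \<in> hall_P_graded C \<gamma>. wform (aut_weight C) u v = 0"
        by (auto simp: hall_P_graded_def wform_commute[of _ _ v])
    next
      assume orth: "\<forall>u \<in> hall_P_graded C \<gamma>. wform (aut_weight C) u v = 0"
      show "v \<in> Prim C"
        unfolding iff
      proof (intro ballI)
        fix a b assume ab: "a \<in> ?I" "b \<in> ?I"
        then obtain \<delta> where \<delta>: "hall_mult_basis C a b \<in> hall_graded C \<delta>"
          using hall_mult_basis_graded[of a b] by auto
        have "hall_mult_basis C a b \<in> hall_P C"
          using ab unfolding hall_P_eq by (intro qvs.span_base) auto
        then show "wform (aut_weight C) v (hall_mult_basis C a b) = 0"
          using \<delta> orth wform_disjoint_degrees[OF v \<delta>]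
          by (cases "\<gamma> = \<delta>") (auto simp: hall_P_graded_def wform_commute[of _ v])
      qed
    qed
  qed
  then show ?thesis
    unfolding Prim_graded_def hall_graded_eq by blast
qed

section \<open>Generation of the graded part by products and indecomposables\<close>

lemma subspace_hall_P_graded: "qvs.subspace (hall_P_graded C \<gamma>)"
  by (simp add: hall_P_graded_def hall_P_def hall_graded_def qvs.subspace_inter)

lemma Ind_subset_degree_classes: "Ind C \<gamma> \<subseteq> degree_classes C \<gamma>"
  by (auto simp: Ind_def indecomposable_def degree_classes_def iso_class_Iso degree_def)

text \<open>Induction on the number of endomorphisms. For a decomposable class [A \<oplus> B] the
  product [A][B] contains it with nonzero coefficient, and the other terms are covered by the
  induction hypothesis, so the equation can be solved for \<open>bvec c\<close>.\<close>

lemma bvec_mem_hall_P_plus_Ind: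
  assumes \<gamma>: "\<gamma> \<noteq> \<one>\<^bsub>Groth C\<^esub>" and "c \<in> degree_classes C \<gamma>"
  shows "bvec c \<in> qvs.span (hall_P_graded C \<gamma> \<union> bvec ` Ind C \<gamma>)"
  using assms(2)
proof (induction "card (homs C (rep c) (rep c))" arbitrary: c rule: less_induct)
  case less
  let ?R = "qvs.span (hall_P_graded C \<gamma> \<union> bvec ` Ind C \<gamma>)"
  have c: "c \<in> Iso C" "c \<noteq> zero_iso_class C" "class_degree C c = \<gamma>"
    using less.prems degree_classes_nonzero[OF \<gamma>] by (auto simp: degree_classes_def)
  note X = Iso_rep[OF c(1)]
  show ?case
  proof (cases "indecomposable C (rep c)")
    case True
    then have "c \<in> Ind C \<gamma>"
      using X c by (auto simp: Ind_def degree_def intro!: exI[of _ "rep c"])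
    then show ?thesis by (intro qvs.span_base) auto
  next
    case False
    have "\<not> is_zero_object C (rep c)"
      using c(2) X zero_object_iff_iso_class[OF X(1)] by simp
    then obtain A B where AB: "is_direct_sum C A B (rep c)" "\<not> is_zero_object C A" "\<not> is_zero_object C B"
      using False X by (auto simp: indecomposable_def)
    then have obj: "A \<in> obj C" "B \<in> obj C"
      by (auto simp: is_direct_sum_def)
    define a b where ab: "a = iso_class C A" "b = iso_class C B"
    have abI: "a \<in> Iso C" "b \<in> Iso C" "a \<noteq> zero_iso_class C" "b \<noteq> zero_iso_class C"
      using obj AB(2,3) by (simp_all add: ab iso_class_Iso zero_object_iff_iso_class)
    let ?F = "class_hall_num C a b"
    let ?K = "{d \<in> Iso C. ?F d \<noteq> 0}"
    have fin: "finite ?K"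
      using finite_hall_mult_basis_support abI by blast
    have repA: "isos C (rep a) A \<noteq> {}" and repB: "isos C (rep b) B \<noteq> {}"
      using isos_rep obj by (simp_all add: ab)
    \<comment> \<open>The structure constants are evaluated at the representatives of
      \<open>a\<close> and \<open>b\<close>, while \<open>rep c\<close> is a direct sum of
      \<open>A\<close> and \<open>B\<close> themselves; \<open>ses_isos\<close> moves between the
      two.\<close>
    have ses_AB: "ses C A B (rep d) \<noteq> {}" if d: "d \<in> ?K" for d
    proof -
      have "ses C (rep a) (rep b) (rep d) \<noteq> {}"
        using d abI class_hall_num_eq_0_iff by auto
      then obtain i p where "(i, p) \<in> ses C (rep a) (rep b) (rep d)" by auto
      moreover have "isos C (rep d) (rep d) \<noteq> {}"
        using d idt_isos Iso_rep(1) by blast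
      ultimately show ?thesis
        using ses_isos repA repB by blast
    qed
    have "c \<in> ?K"
    proof -
      obtain i p where "(i, p) \<in> ses C A B (rep c)"
        using ses_if_direct_sum[OF AB(1)] by auto
      moreover have "isos C A (rep a) \<noteq> {}" "isos C B (rep b) \<noteq> {}" "isos C (rep c) (rep c) \<noteq> {}"
        using repA repB idt_isos[OF X(1)] isos_obtain_inverse by blast+
      ultimately have "ses C (rep a) (rep b) (rep c) \<noteq> {}"
        by (rule ses_isos)
      then show ?thesis
        using c(1) abI class_hall_num_eq_0_iff by blast
    qed
    \<comment> \<open>The product is homogeneous and \<open>c\<close> occurs in it, so its degree
      must be \<gamma>.\<close>
    obtain \<delta> where "?K \<subseteq> degree_classes C \<delta>"
      using hall_mult_basis_support[OF abI(1,2)] by blast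
    then have K\<gamma>: "?K \<subseteq> degree_classes C \<gamma>"
      using \<open>c \<in> ?K\<close> c(3) by (auto simp: degree_classes_def)
    have smaller: "card (homs C (rep d) (rep d)) < card (homs C (rep c) (rep c))" if d: "d \<in> ?K - {c}" for d
    proof (rule card_End_less_direct_sum[OF hom_finite _ AB(1)])
      show "ses C A B (rep d) \<noteq> {}"
        using ses_AB d by blast
      \<comment> \<open>A second direct sum of \<open>A\<close> and \<open>B\<close> would be
        isomorphic to \<open>rep c\<close>, forcing \<open>d = c\<close>.\<close>
      show "\<not> is_direct_sum C A B (rep d)"
      proof
        assume "is_direct_sum C A B (rep d)"
        then have "isos C (rep d) (rep c) \<noteq> {}"
          using AB(1) is_biproduct_isos by (auto simp: is_direct_sum_def)
        then have "iso_class C (rep d) = iso_class C (rep c)"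
          using iso_class_eqI by blast
        then show False
          using d X Iso_rep(2) by auto
      qed
    qed
    have "bvec d \<in> ?R" if "d \<in> ?K - {c}" for d
      using less.hyps[OF smaller[OF that]] K\<gamma> that by blast
    then have rest: "(\<Sum>d \<in> ?K - {c}. qscale (?F d) (bvec d)) \<in> ?R"
      by (intro qvs.span_sum qvs.span_scale)
    have prod: "hall_mult_basis C a b = qscale (?F c) (bvec c) + (\<Sum>d \<in> ?K - {c}. qscale (?F d) (bvec d))"
      unfolding hall_mult_basis_def using fin \<open>c \<in> ?K\<close> by (rule sum.remove)
    have "hall_mult_basis C a b \<in> hall_P C"
      using abI unfolding hall_P_eq by (intro qvs.span_base) auto
    moreover have "hall_mult_basis C a b \<in> hall_graded C \<gamma>"
      unfolding hall_mult_basis_def hall_graded_eq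
      using K\<gamma> by (intro qvs.span_sum qvs.span_scale qvs.span_base) blast
    ultimately have "hall_mult_basis C a b \<in> ?R"
      by (intro qvs.span_base) (simp add: hall_P_graded_def)
    then have "qscale (?F c) (bvec c) \<in> ?R"
      using qvs.span_diff[OF _ rest] prod by fastforce
    then have "qscale (1 / ?F c) (qscale (?F c) (bvec c)) \<in> ?R"
      by (rule qvs.span_scale)
    then show ?thesis
      using \<open>c \<in> ?K\<close> by simp
  qed
qed

lemma hall_graded_eq_sum:
  assumes "\<gamma> \<noteq> \<one>\<^bsub>Groth C\<^esub>"
  shows "{x + y | x y. x \<in> hall_P_graded C \<gamma> \<and> y \<in> qvs.span (bvec ` Ind C \<gamma>)} = hall_graded C \<gamma>"
proof -
  have "qvs.span (hall_P_graded C \<gamma> \<union> bvec ` Ind C \<gamma>) = hall_graded C \<gamma>"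
  proof
    show "qvs.span (hall_P_graded C \<gamma> \<union> bvec ` Ind C \<gamma>) \<subseteq> hall_graded C \<gamma>"
    proof (rule qvs.span_minimal)
      have "bvec ` Ind C \<gamma> \<subseteq> hall_graded C \<gamma>"
        using Ind_subset_degree_classes unfolding hall_graded_eq by (blast intro: qvs.span_base)
      then show "hall_P_graded C \<gamma> \<union> bvec ` Ind C \<gamma> \<subseteq> hall_graded C \<gamma>"
        by (simp add: hall_P_graded_def)
      show "qvs.subspace (hall_graded C \<gamma>)"
        by (simp add: hall_graded_def)
    qed
    show "hall_graded C \<gamma> \<subseteq> qvs.span (hall_P_graded C \<gamma> \<union> bvec ` Ind C \<gamma>)"
      unfolding hall_graded_eq
      using bvec_mem_hall_P_plus_Ind[OF assms] by (intro qvs.span_minimal) auto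
  qed
  moreover have "qvs.span (hall_P_graded C \<gamma>) = hall_P_graded C \<gamma>"
    using subspace_hall_P_graded by (simp add: qvs.span_eq_iff)
  ultimately show ?thesis
    by (simp add: qvs.span_Un)
qed

end

section \<open>The dimension count in a fixed nonzero degree\<close>

theorem proposition2p20:
  fixes C :: "('o, 'm) exact_cat" and \<gamma> :: "'o set set"
  assumes "exact_category C" and "profinitary C" and "cofinitary C"
    and "\<gamma> \<in> carrier (Groth C) - {\<one>\<^bsub>Groth C\<^esub>}"
  shows "hall_m C \<gamma> = int (qvs.dim (hall_P_graded C \<gamma> \<inter> qvs.span (bvec ` Ind C \<gamma>))) \<and>
    (bvec ` Ind C \<gamma> \<subseteq> hall_P_graded C \<gamma> \<longrightarrow> Prim_graded C \<gamma> = {0})"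
proof -
  interpret finitary_exact_category C
    using assms(1-3) by (simp add: finitary_exact_category_def finitary_exact_category_axioms_def)
  have \<gamma>: "\<gamma> \<in> carrier (Groth C)" "\<gamma> \<noteq> \<one>\<^bsub>Groth C\<^esub>"
    using assms(4) by auto
  let ?S = "degree_classes C \<gamma>" and ?P = "hall_P_graded C \<gamma>" and ?Q = "qvs.span (bvec ` Ind C \<gamma>)"
  have fin: "finite ?S"
    using \<gamma>(1) by (rule finite_degree_classes)
  have pos: "aut_weight C b > 0" if "b \<in> ?S" for b
    using that aut_weight_pos by (simp add: degree_classes_def)
  have P: "qvs.subspace ?P" "?P \<subseteq> qvs.span (bvec ` ?S)"
    using subspace_hall_P_graded by (auto simp: hall_P_graded_def hall_graded_eq)
  have "?Q \<subseteq> qvs.span (bvec ` ?S)"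
    using Ind_subset_degree_classes by (intro qvs.span_mono image_mono)
  then have "qvs.dim (hall_graded C \<gamma>) + qvs.dim (?P \<inter> ?Q) = qvs.dim ?P + qvs.dim ?Q"
    using qvs.dim_sums_Int_finite_span[OF P(1) qvs.subspace_span finite_imageI[OF fin] P(2)]
    unfolding hall_graded_eq_sum[OF \<gamma>(2), symmetric] by blast
  moreover have "qvs.dim ?P + qvs.dim (Prim_graded C \<gamma>) = card ?S"
    unfolding Prim_graded_eq_orthogonal_complement[OF \<gamma>(2)]
    using dim_orthogonal_complement[OF fin pos P] .
  \<comment> \<open>Both displayed identities contain dim H = \<open>card ?S\<close>, and dim
    \<open>?Q\<close> is the number of indecomposable classes; eliminating dim \<open>?P\<close>
    gives the formula. The rule \<open>qvs.dim_span\<close> is removed so that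
    \<open>dim_span_bvec\<close> still matches.\<close>
  ultimately have "hall_m C \<gamma> = int (qvs.dim (?P \<inter> ?Q))"
    by (simp add: hall_m_def hall_graded_eq dim_span_bvec del: qvs.dim_span)
  moreover have "Prim_graded C \<gamma> = {0}" if "bvec ` Ind C \<gamma> \<subseteq> ?P"
  proof -
    have "?Q \<subseteq> ?P"
      using that P(1) by (rule qvs.span_minimal)
    then have "hall_graded C \<gamma> \<subseteq> ?P"
      unfolding hall_graded_eq_sum[OF \<gamma>(2), symmetric] using qvs.subspace_add[OF P(1)] by blast
    \<comment> \<open>Now \<open>?P\<close> is the whole graded part, so \<open>v\<close> is
      orthogonal to itself and positivity makes it zero.\<close>
    then have "v = 0" if "v \<in> Prim_graded C \<gamma>" for v
      using that pos wform_pos[of v "aut_weight C"]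
      by (auto simp: Prim_graded_eq_orthogonal_complement[OF \<gamma>(2)] hall_graded_eq span_bvec subset_iff)
    moreover have "0 \<in> Prim_graded C \<gamma>"
      by (simp add: Prim_graded_eq_orthogonal_complement[OF \<gamma>(2)] qvs.span_zero)
    ultimately show ?thesis by blast
  qed
  ultimately show ?thesis by blast
qed

end
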